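(* Let $\rho$ and $\sigma$ be highest weights of irreducible representations $V$ and $W$ of $\mathrm{GL}(g)$, respectively. Let $f$ be a modular form of weight $\rho$, i.e. a section of $\mathbb{E}_\rho$ over $X$, and let $I$ be a concomitant of type $(d,\sigma)$ for the action of $\mathrm{GL}(g)$ on $V$, given by a $\mathrm{GL}(g)$-equivariant embedding $\phi: W\hookrightarrow \mathrm{Sym}^d(V)$. Then applying $I$ to $f$ yields a modular form of weight $\sigma$, i.e. a section of $\mathbb{E}_\sigma$ over $X$.
   Context: Setting: $X$ is a complex analytic space (or orbifold or stack), for instance an arithmetic quotient of a bounded symmetric domain or a moduli space of abelian varieties or of curves (or a compactification of it to which the Hodge bundle extends), carrying a holomorphic vector bundle $\mathbb{E}$ of rank $g$ (the Hodge bundle). For an irreducible (finite-dimensional, rational, complex) representation $V$ of $\mathrm{GL}(g)$ of highest weight $\rho$, $\mathbb{E}_\rho$ denotes the vector bundle on $X$ obtained from $\mathbb{E}$ by the Schur functor defined by $\rho$, that is, the bundle with fibre $V$ associated with the frame bundle of $\mathbb{E}$ via the representation $V$. A modular form of weight $\rho$ is a holomorphic section of $\mathbb{E}_\rho$ over $X$. (On a quotient $\Gamma\backslash D$ of a bounded symmetric domain $D$ on which $\mathbb{E}$ is given by a factor of automorphy $j:\Gamma\times D\to \mathrm{GL}(g,\mathbb{C})$, such a section is a holomorphic function $f:D\to V$ with $f(\gamma z)=\rho(j(\gamma,z))f(z)$ for all $\gamma\in\Gamma$, $z\in D$.) A concomitant of type $(d,\sigma)$ for $\rho$ is given by a $\mathrm{GL}(g)$-equivariant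 embedding $\phi:W\hookrightarrow \mathrm{Sym}^d(V)$, where $W$ is the irreducible representation of $\mathrm{GL}(g)$ of highest weight $\sigma$. (The case where $W=\det(U)^{\otimes m}$, with $U$ the standard representation, is that of an invariant.) Applying the concomitant to $f$ means the following: $\mathrm{Sym}^d(f)$ is the section $f^d$ of $\mathrm{Sym}^d(\mathbb{E}_\rho)$, and one projects it to $\mathbb{E}_\sigma$, viewed as a direct summand of $\mathrm{Sym}^d(\mathbb{E}_\rho)$ via $\phi$; that is, one takes the image of $f^d$ under the bundle map $\mathrm{Sym}^d(\mathbb{E}_\rho)\to\mathbb{E}_\sigma$ induced by a $\mathrm{GL}(g)$-equivariant projection $p:\mathrm{Sym}^d(V)\to W$ with $p\circ\phi=\mathrm{id}_W$. *)

theory Defs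
  imports
    "HOL-Analysis.Analysis"
    "HOL-Algebra.Ring"
    "HOL-Library.Poly_Mapping"
begin

section \<open>Spaces ringed in complex algebras\<close>

text \<open>
  The structure sheaf is not assumed to consist of functions, so that non-reduced complex spaces
  are included. \<open>secs X U\<close> is the ring of sections over the open set \<open>U\<close>, \<open>res X V U\<close> is the
  restriction from \<open>V\<close> to \<open>U\<close>, and \<open>cst X U\<close> is the structure map of the complex algebra
  \<open>secs X U\<close>.
\<close>

definition complex_ring :: "complex ring" where
  "complex_ring = \<lparr>carrier = UNIV, mult = (*), one = 1, zero = 0, add = (+)\<rparr>"

record ('x, 'r) ringed =
  tops :: "'x topology"
  secs :: "'x set \<Rightarrow> 'r ring"
  res :: "'x set \<Rightarrow> 'x set \<Rightarrow> 'r \<Rightarrow> 'r"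
  cst :: "'x set \<Rightarrow> complex \<Rightarrow> 'r"

definition ringed_space :: "('x, 'r) ringed \<Rightarrow> bool" where
  "ringed_space X \<longleftrightarrow>
    (\<forall>U. openin (tops X) U \<longrightarrow>
        cring (secs X U) \<and> cst X U \<in> ring_hom complex_ring (secs X U) \<and>
        (\<forall>s\<in>carrier (secs X U). res X U U s = s)) \<and>
    (\<forall>U V. openin (tops X) U \<and> openin (tops X) V \<and> U \<subseteq> V \<longrightarrow>
        res X V U \<in> ring_hom (secs X V) (secs X U) \<and>
        (\<forall>c. res X V U (cst X V c) = cst X U c)) \<and>
    (\<forall>U V W. openin (tops X) U \<and> openin (tops X) V \<and> openin (tops X) W \<and> U \<subseteq> V \<and> V \<subseteq> W \<longrightarrow>
        (\<forall>s\<in>carrier (secs X W). res X V U (res X W V s) = res X W U s)) \<and>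
    (\<forall>\<U> s. (\<forall>U\<in>\<U>. openin (tops X) U \<and> s U \<in> carrier (secs X U)) \<and>
        (\<forall>U\<in>\<U>. \<forall>V\<in>\<U>. res X U (U \<inter> V) (s U) = res X V (U \<inter> V) (s V)) \<longrightarrow>
        (\<exists>!t. t \<in> carrier (secs X (\<Union>\<U>)) \<and> (\<forall>U\<in>\<U>. res X (\<Union>\<U>) U t = s U)))"

definition preim :: "('x, 'r) ringed \<Rightarrow> ('x \<Rightarrow> 'y) \<Rightarrow> 'y set \<Rightarrow> 'x set" where
  "preim X h V = {p \<in> topspace (tops X). h p \<in> V}"

text \<open>
  A morphism is a continuous map together with a comorphism of sheaves of complex algebras. Between
  complex spaces the stalk maps are automatically local.
\<close>

type_synonym ('x, 'r, 'y, 's) morph = "('x \<Rightarrow> 'y) \<times> ('y set \<Rightarrow> 's \<Rightarrow> 'r)"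

definition morphism ::
    "('x, 'r) ringed \<Rightarrow> ('y, 's) ringed \<Rightarrow> ('x, 'r, 'y, 's) morph \<Rightarrow> bool" where
  "morphism X Y m \<longleftrightarrow>
    continuous_map (tops X) (tops Y) (fst m) \<and>
    (\<forall>V. openin (tops Y) V \<longrightarrow>
        snd m V \<in> ring_hom (secs Y V) (secs X (preim X (fst m) V)) \<and>
        (\<forall>c. snd m V (cst Y V c) = cst X (preim X (fst m) V) c)) \<and>
    (\<forall>U V. openin (tops Y) U \<and> openin (tops Y) V \<and> U \<subseteq> V \<longrightarrow>
        (\<forall>s\<in>carrier (secs Y V). snd m U (res Y V U s) =
            res X (preim X (fst m) V) (preim X (fst m) U) (snd m V s)))"

definition isomorphic_spaces :: "('x, 'r) ringed \<Rightarrow> ('y, 's) ringed \<Rightarrow> bool" where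
  "isomorphic_spaces X Y \<longleftrightarrow>
    (\<exists>m. morphism X Y m \<and> homeomorphic_map (tops X) (tops Y) (fst m) \<and>
      (\<forall>V. openin (tops Y) V \<longrightarrow>
        bij_betw (snd m V) (carrier (secs Y V)) (carrier (secs X (preim X (fst m) V)))))"

definition open_subspace :: "('x, 'r) ringed \<Rightarrow> 'x set \<Rightarrow> ('x, 'r) ringed" where
  "open_subspace X U = X\<lparr>tops := subtopology (tops X) U\<rparr>"


section \<open>Complex analytic spaces\<close>

text \<open>
  The dimension of the ambient space of a local model varies from point to point, so affine
  \<open>n\<close>-space is realised as the sequences vanishing from index \<open>n\<close> on.
\<close>

definition aff :: "nat \<Rightarrow> (nat \<Rightarrow> complex) set" where
  "aff n = {z. \<forall>i\<ge>n. z i = 0}"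

definition holo :: "nat \<Rightarrow> ((nat \<Rightarrow> complex) \<Rightarrow> complex) \<Rightarrow> (nat \<Rightarrow> complex) set \<Rightarrow> bool" where
  "holo n h D \<longleftrightarrow>
    (\<forall>z\<in>D. \<exists>L :: nat \<Rightarrow> complex.
      ((\<lambda>w. (h w - h z - (\<Sum>i<n. L i * (w i - z i))) / of_real (\<Sum>i<n. cmod (w i - z i)))
        \<longlongrightarrow> 0) (at z within aff n))"

text \<open>
  \<open>germ n fs z h\<close> is the class of \<open>h\<close> in the quotient of the ring of germs of holomorphic functions
  at \<open>z\<close> by the ideal generated by \<open>fs\<close>. Its elements are total functions, of which only the
  behaviour near \<open>z\<close> matters.
\<close>

definition germ ::
    "nat \<Rightarrow> ((nat \<Rightarrow> complex) \<Rightarrow> complex) list \<Rightarrow> (nat \<Rightarrow> complex) \<Rightarrow>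
     ((nat \<Rightarrow> complex) \<Rightarrow> complex) \<Rightarrow> ((nat \<Rightarrow> complex) \<Rightarrow> complex) set" where
  "germ n fs z h =
    {k. \<exists>N a. openin (top_of_set (aff n)) N \<and> z \<in> N \<and> holo n k N \<and>
        (\<forall>j<length fs. holo n (a j) N) \<and>
        (\<forall>w\<in>N. k w - h w = (\<Sum>j<length fs. a j w * (fs ! j) w))}"

text \<open>
  The local model cut out of the domain \<open>D\<close> by \<open>fs\<close>: the sections of the quotient sheaf are the
  families of germ classes that are locally induced by one holomorphic function.
\<close>

definition model_secs ::
    "nat \<Rightarrow> ((nat \<Rightarrow> complex) \<Rightarrow> complex) list \<Rightarrow> (nat \<Rightarrow> complex) set \<Rightarrow>
     ((nat \<Rightarrow> complex) \<Rightarrow> ((nat \<Rightarrow> complex) \<Rightarrow> complex) set) ring" where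
  "model_secs n fs V =
    \<lparr>carrier = {s \<in> extensional V. \<forall>z\<in>V. \<exists>N h. openin (top_of_set (aff n)) N \<and> z \<in> N \<and>
        holo n h N \<and> (\<forall>w\<in>V \<inter> N. s w = germ n fs w h)},
     mult = (\<lambda>s t. \<lambda>z\<in>V. \<Union>a\<in>s z. \<Union>b\<in>t z. germ n fs z (\<lambda>w. a w * b w)),
     one = (\<lambda>z\<in>V. germ n fs z (\<lambda>w. 1)),
     zero = (\<lambda>z\<in>V. germ n fs z (\<lambda>w. 0)),
     add = (\<lambda>s t. \<lambda>z\<in>V. \<Union>a\<in>s z. \<Union>b\<in>t z. germ n fs z (\<lambda>w. a w + b w))\<rparr>"

definition model_space ::
    "nat \<Rightarrow> (nat \<Rightarrow> complex) set \<Rightarrow> ((nat \<Rightarrow> complex) \<Rightarrow> complex) list \<Rightarrow>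
     (nat \<Rightarrow> complex, (nat \<Rightarrow> complex) \<Rightarrow> ((nat \<Rightarrow> complex) \<Rightarrow> complex) set) ringed" where
  "model_space n D fs =
    \<lparr>tops = top_of_set {z \<in> D. \<forall>f\<in>set fs. f z = 0},
     secs = model_secs n fs,
     res = (\<lambda>V U s. restrict s U),
     cst = (\<lambda>V c. \<lambda>z\<in>V. germ n fs z (\<lambda>w. c))\<rparr>"

definition complex_space :: "('x, 'r) ringed \<Rightarrow> bool" where
  "complex_space X \<longleftrightarrow>
    ringed_space X \<and> Hausdorff_space (tops X) \<and>
    (\<forall>x\<in>topspace (tops X). \<exists>U n D fs. openin (tops X) U \<and> x \<in> U \<and>
        openin (top_of_set (aff n)) D \<and> (\<forall>f\<in>set fs. holo n f D) \<and>
        isomorphic_spaces (open_subspace X U) (model_space n D fs))"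


section \<open>Spaces, orbifolds and stacks\<close>

text \<open>
  A complex analytic stack is presented by a diagram (a functor from a small category) of complex
  analytic spaces, of which it is the 2-colimit. Vector bundles on the stack are then the compatible
  families of vector bundles on the spaces of the diagram, and likewise for sections.
  One object with only its identity arrow gives a single complex analytic space. One object \<open>D\<close> with
  a group \<open>\<Gamma>\<close> of arrows gives the quotient of \<open>D\<close> by \<open>\<Gamma>\<close>. An orbifold atlas in the sense of Satake
  (charts and their injections) gives an orbifold. A general stack is presented by the category of
  its objects over complex analytic spaces, or by the nerve of a groupoid.
\<close>

record ('o, 'a, 'x, 'r) diagram =
  objs :: "'o set"
  arrs :: "'a set"
  src :: "'a \<Rightarrow> 'o"
  tgt :: "'a \<Rightarrow> 'o"
  idn :: "'o \<Rightarrow> 'a"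
  cmp :: "'a \<Rightarrow> 'a \<Rightarrow> 'a"
  spc :: "'o \<Rightarrow> ('x, 'r) ringed"
  mor :: "'a \<Rightarrow> ('x, 'r, 'x, 'r) morph"

abbreviation base_map :: "('o, 'a, 'x, 'r) diagram \<Rightarrow> 'a \<Rightarrow> 'x \<Rightarrow> 'x" where
  "base_map X a \<equiv> fst (mor X a)"

abbreviation pullback :: "('o, 'a, 'x, 'r) diagram \<Rightarrow> 'a \<Rightarrow> 'x set \<Rightarrow> 'r \<Rightarrow> 'r" where
  "pullback X a \<equiv> snd (mor X a)"

definition composable :: "('o, 'a, 'x, 'r) diagram \<Rightarrow> 'a \<Rightarrow> 'a \<Rightarrow> bool" where
  "composable X b a \<longleftrightarrow> a \<in> arrs X \<and> b \<in> arrs X \<and> tgt X a = src X b"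

definition analytic_stack :: "('o, 'a, 'x, 'r) diagram \<Rightarrow> bool" where
  "analytic_stack X \<longleftrightarrow>
    (\<forall>x\<in>objs X. complex_space (spc X x)) \<and>
    (\<forall>a\<in>arrs X. src X a \<in> objs X \<and> tgt X a \<in> objs X \<and>
        morphism (spc X (src X a)) (spc X (tgt X a)) (mor X a)) \<and>
    (\<forall>x\<in>objs X. idn X x \<in> arrs X \<and> src X (idn X x) = x \<and> tgt X (idn X x) = x \<and>
        (\<forall>p\<in>topspace (tops (spc X x)). base_map X (idn X x) p = p) \<and>
        (\<forall>V. openin (tops (spc X x)) V \<longrightarrow>
            (\<forall>s\<in>carrier (secs (spc X x) V). pullback X (idn X x) V s = s))) \<and>
    (\<forall>a\<in>arrs X. cmp X a (idn X (src X a)) = a \<and> cmp X (idn X (tgt X a)) a = a) \<and>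
    (\<forall>a b. composable X b a \<longrightarrow>
        cmp X b a \<in> arrs X \<and> src X (cmp X b a) = src X a \<and> tgt X (cmp X b a) = tgt X b \<and>
        (\<forall>p\<in>topspace (tops (spc X (src X a))).
            base_map X (cmp X b a) p = base_map X b (base_map X a p)) \<and>
        (\<forall>V. openin (tops (spc X (tgt X b))) V \<longrightarrow>
            (\<forall>s\<in>carrier (secs (spc X (tgt X b)) V). pullback X (cmp X b a) V s =
                pullback X a (preim (spc X (src X b)) (base_map X b) V) (pullback X b V s)))) \<and>
    (\<forall>a b c. composable X b a \<and> composable X c b \<longrightarrow>
        cmp X c (cmp X b a) = cmp X (cmp X c b) a)"


section \<open>Matrices over commutative complex algebras\<close>

text \<open>
  Below, \<open>R\<close> is a commutative ring and \<open>c\<close> the structure map of a complex algebra on it; they will be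
  \<open>secs X U\<close> and \<open>cst X U\<close>. A matrix is a function of its row and column index.
\<close>

definition ring_mult_mat ::
    "'r ring \<Rightarrow> ('m \<Rightarrow> 'k::finite \<Rightarrow> 'r) \<Rightarrow> ('k \<Rightarrow> 'l \<Rightarrow> 'r) \<Rightarrow> 'm \<Rightarrow> 'l \<Rightarrow> 'r" where
  "ring_mult_mat R A B = (\<lambda>i j. \<Oplus>\<^bsub>R\<^esub>k\<in>UNIV. A i k \<otimes>\<^bsub>R\<^esub> B k j)"

definition ring_mult_vec ::
    "'r ring \<Rightarrow> ('m \<Rightarrow> 'k::finite \<Rightarrow> 'r) \<Rightarrow> ('k \<Rightarrow> 'r) \<Rightarrow> 'm \<Rightarrow> 'r" where
  "ring_mult_vec R A v = (\<lambda>i. \<Oplus>\<^bsub>R\<^esub>k\<in>UNIV. A i k \<otimes>\<^bsub>R\<^esub> v k)"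

definition ring_det ::
    "'r ring \<Rightarrow> (complex \<Rightarrow> 'r) \<Rightarrow> ('g::finite \<Rightarrow> 'g \<Rightarrow> 'r) \<Rightarrow> 'r" where
  "ring_det R c A =
    (\<Oplus>\<^bsub>R\<^esub>\<pi>\<in>{\<pi>. \<pi> permutes UNIV}. c (of_int (sign \<pi>)) \<otimes>\<^bsub>R\<^esub> (\<Otimes>\<^bsub>R\<^esub>i\<in>UNIV. A i (\<pi> i)))"

definition ring_GL ::
    "'r ring \<Rightarrow> (complex \<Rightarrow> 'r) \<Rightarrow> ('g::finite \<Rightarrow> 'g \<Rightarrow> 'r) set" where
  "ring_GL R c = {A. (\<forall>i j. A i j \<in> carrier R) \<and> ring_det R c A \<in> Units R}"


section \<open>Rational representations of the general linear group\<close>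

text \<open>
  Polynomials in variables indexed by \<open>'i\<close> are elements of the monoid algebra
  \<open>('i \<Rightarrow>\<^sub>0 nat) \<Rightarrow>\<^sub>0 complex\<close>. \<open>GL(g)\<close> is the group of invertible elements of
  \<open>complex^'g^'g\<close>, and a representation on the space \<open>complex^'v\<close> is given by a map
  \<open>complex^'g^'g \<Rightarrow> complex^'v^'v\<close>, of which only the values at invertible matrices matter.
\<close>

definition poly_eval ::
    "'r ring \<Rightarrow> (complex \<Rightarrow> 'r) \<Rightarrow> ('i::finite \<Rightarrow> 'r) \<Rightarrow> (('i \<Rightarrow>\<^sub>0 nat) \<Rightarrow>\<^sub>0 complex) \<Rightarrow> 'r" where
  "poly_eval R c x P =
    (\<Oplus>\<^bsub>R\<^esub>m\<in>Poly_Mapping.keys P. c (Poly_Mapping.lookup P m) \<otimes>\<^bsub>R\<^esub>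
        (\<Otimes>\<^bsub>R\<^esub>i\<in>UNIV. x i [^]\<^bsub>R\<^esub> Poly_Mapping.lookup m i))"

definition rational_coeffs ::
    "(complex^'g^'g \<Rightarrow> complex^'v^'v) \<Rightarrow> nat \<Rightarrow>
     ('v \<Rightarrow> 'v \<Rightarrow> (('g::finite \<times> 'g) \<Rightarrow>\<^sub>0 nat) \<Rightarrow>\<^sub>0 complex) \<Rightarrow> bool" where
  "rational_coeffs \<rho> k P \<longleftrightarrow>
    (\<forall>A. invertible A \<longrightarrow> (\<forall>i j. det A ^ k * \<rho> A $ i $ j =
        poly_eval complex_ring id (\<lambda>(a, b). A $ a $ b) (P i j)))"

definition rational_rep :: "(complex^'g^'g \<Rightarrow> complex^'v^'v) \<Rightarrow> bool" where
  "rational_rep \<rho> \<longleftrightarrow>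
    \<rho> (mat 1) = mat 1 \<and>
    (\<forall>A B. invertible A \<and> invertible B \<longrightarrow> \<rho> (A ** B) = \<rho> A ** \<rho> B) \<and>
    (\<exists>k P. rational_coeffs \<rho> k P)"

definition irreducible_rep :: "(complex^'g^'g \<Rightarrow> complex^'v^'v) \<Rightarrow> bool" where
  "irreducible_rep \<rho> \<longleftrightarrow>
    rational_rep \<rho> \<and>
    (\<forall>S. vec.subspace S \<and> (\<forall>A. invertible A \<longrightarrow> (\<forall>v\<in>S. \<rho> A *v v \<in> S)) \<longrightarrow>
        S = {0} \<or> S = UNIV)"

text \<open>Highest weights refer to the Borel subgroup of upper triangular matrices.\<close>

definition has_highest_weight ::
    "(complex^'g::_^'g::_ \<Rightarrow> complex^'v^'v) \<Rightarrow> ('g::{finite, linorder} \<Rightarrow> int) \<Rightarrow> bool" where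
  "has_highest_weight \<rho> wt \<longleftrightarrow>
    (\<exists>v. v \<noteq> 0 \<and>
      (\<forall>A. (\<forall>i. A $ i $ i = 1) \<and> (\<forall>i j. j < i \<longrightarrow> A $ i $ j = 0) \<longrightarrow> \<rho> A *v v = v) \<and>
      (\<forall>t. (\<forall>i. t i \<noteq> 0) \<longrightarrow>
          \<rho> (\<chi> i j. if i = j then t i else 0) *v v = (\<Prod>i\<in>UNIV. t i powi wt i) *s v))"

text \<open>
  The value of a rational representation at a matrix over \<open>R\<close>, that is, the homomorphism
  \<open>GL(g, R) \<rightarrow> GL(V \<otimes> R)\<close> induced by the morphism of algebraic groups \<open>\<rho>\<close>. The result does not
  depend on the choice of the exponent and of the polynomials.
\<close>

definition rep_over ::
    "'r ring \<Rightarrow> (complex \<Rightarrow> 'r) \<Rightarrow> (complex^'g^'g \<Rightarrow> complex^'v^'v) \<Rightarrow>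
     ('g::finite \<Rightarrow> 'g \<Rightarrow> 'r) \<Rightarrow> 'v \<Rightarrow> 'v \<Rightarrow> 'r" where
  "rep_over R c \<rho> A =
    (let (k, P) = (SOME kP. rational_coeffs \<rho> (fst kP) (snd kP)) in
      (\<lambda>i j. (inv\<^bsub>R\<^esub> (ring_det R c A)) [^]\<^bsub>R\<^esub> k \<otimes>\<^bsub>R\<^esub>
        poly_eval R c (\<lambda>(a, b). A a b) (P i j)))"


section \<open>Symmetric powers and concomitants\<close>

text \<open>
  The symmetric algebra of \<open>complex^'v\<close> is the polynomial algebra on the standard basis; its elements
  of degree \<open>d\<close> form the \<open>d\<close>-th symmetric power.
\<close>

definition mdeg :: "('v::finite \<Rightarrow>\<^sub>0 nat) \<Rightarrow> nat" where
  "mdeg m = (\<Sum>i\<in>UNIV. Poly_Mapping.lookup m i)"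

definition Sym :: "nat \<Rightarrow> (('v::finite \<Rightarrow>\<^sub>0 nat) \<Rightarrow>\<^sub>0 complex) set" where
  "Sym d = {P. \<forall>m\<in>Poly_Mapping.keys P. mdeg m = d}"

definition sscale ::
    "complex \<Rightarrow> (('v \<Rightarrow>\<^sub>0 nat) \<Rightarrow>\<^sub>0 complex) \<Rightarrow> ('v \<Rightarrow>\<^sub>0 nat) \<Rightarrow>\<^sub>0 complex" where
  "sscale c P = Poly_Mapping.single 0 c * P"

text \<open>The inclusion of \<open>complex^'v\<close> as the elements of degree 1.\<close>

definition linear_form :: "complex^'v \<Rightarrow> ('v::finite \<Rightarrow>\<^sub>0 nat) \<Rightarrow>\<^sub>0 complex" where
  "linear_form v = (\<Sum>i\<in>UNIV. Poly_Mapping.single (Poly_Mapping.single i 1) (v $ i))"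

text \<open>The algebra endomorphism induced by the linear map with matrix \<open>A\<close>.\<close>

definition sym_map ::
    "complex^'v^'v \<Rightarrow> (('v::finite \<Rightarrow>\<^sub>0 nat) \<Rightarrow>\<^sub>0 complex) \<Rightarrow> ('v \<Rightarrow>\<^sub>0 nat) \<Rightarrow>\<^sub>0 complex" where
  "sym_map A P =
    (\<Sum>m\<in>Poly_Mapping.keys P. sscale (Poly_Mapping.lookup P m)
        (\<Prod>j\<in>UNIV. linear_form (column j A) ^ Poly_Mapping.lookup m j))"

definition concomitant ::
    "nat \<Rightarrow> (complex^'g^'g \<Rightarrow> complex^'v^'v) \<Rightarrow> (complex^'g^'g \<Rightarrow> complex^'w^'w) \<Rightarrow>
     (complex^'w \<Rightarrow> ('v::finite \<Rightarrow>\<^sub>0 nat) \<Rightarrow>\<^sub>0 complex) \<Rightarrow> bool" where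
  "concomitant d \<rho> \<sigma> \<phi> \<longleftrightarrow>
    (\<forall>w. \<phi> w \<in> Sym d) \<and> inj \<phi> \<and>
    (\<forall>v w. \<phi> (v + w) = \<phi> v + \<phi> w) \<and> (\<forall>c w. \<phi> (c *s w) = sscale c (\<phi> w)) \<and>
    (\<forall>A w. invertible A \<longrightarrow> \<phi> (\<sigma> A *v w) = sym_map (\<rho> A) (\<phi> w))"

definition equivariant_projection ::
    "nat \<Rightarrow> (complex^'g^'g \<Rightarrow> complex^'v^'v) \<Rightarrow> (complex^'g^'g \<Rightarrow> complex^'w^'w) \<Rightarrow>
     (complex^'w \<Rightarrow> ('v::finite \<Rightarrow>\<^sub>0 nat) \<Rightarrow>\<^sub>0 complex) \<Rightarrow>
     ((('v \<Rightarrow>\<^sub>0 nat) \<Rightarrow>\<^sub>0 complex) \<Rightarrow> complex^'w) \<Rightarrow> bool" where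
  "equivariant_projection d \<rho> \<sigma> \<phi> p \<longleftrightarrow>
    (\<forall>P\<in>Sym d. \<forall>Q\<in>Sym d. p (P + Q) = p P + p Q) \<and>
    (\<forall>c. \<forall>P\<in>Sym d. p (sscale c P) = c *s p P) \<and>
    (\<forall>A. \<forall>P\<in>Sym d. invertible A \<longrightarrow> p (sym_map (\<rho> A) P) = \<sigma> A *v p P) \<and>
    (\<forall>w. p (\<phi> w) = w)"

text \<open>
  Elements of \<open>Sym\<^sup>d(V) \<otimes> R\<close> are given by their coefficients at the monomials of degree \<open>d\<close>.
  \<open>sym_power R d v\<close> is the \<open>d\<close>-th power of \<open>v \<in> V \<otimes> R\<close> in the symmetric algebra, expanded as a sum
  over all words of length \<open>d\<close> in the basis elements.
\<close>

definition sym_power ::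
    "'r ring \<Rightarrow> nat \<Rightarrow> ('v::finite \<Rightarrow> 'r) \<Rightarrow> ('v \<Rightarrow>\<^sub>0 nat) \<Rightarrow> 'r" where
  "sym_power R d v m =
    (\<Oplus>\<^bsub>R\<^esub>l\<in>{l. length l = d \<and> sum_list (map (\<lambda>i. Poly_Mapping.single i 1) l) = m}.
        \<Otimes>\<^bsub>R\<^esub>k\<in>{..<d}. v (l ! k))"

text \<open>The extension of scalars \<open>Sym\<^sup>d(V) \<otimes> R \<rightarrow> W \<otimes> R\<close> of a linear map \<open>p\<close>.\<close>

definition proj_over ::
    "'r ring \<Rightarrow> (complex \<Rightarrow> 'r) \<Rightarrow> nat \<Rightarrow>
     ((('v::finite \<Rightarrow>\<^sub>0 nat) \<Rightarrow>\<^sub>0 complex) \<Rightarrow> complex^'w) \<Rightarrow>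
     (('v \<Rightarrow>\<^sub>0 nat) \<Rightarrow> 'r) \<Rightarrow> 'w \<Rightarrow> 'r" where
  "proj_over R c d p s =
    (\<lambda>k. \<Oplus>\<^bsub>R\<^esub>m\<in>{m. mdeg m = d}. c (p (Poly_Mapping.single m 1) $ k) \<otimes>\<^bsub>R\<^esub> s m)"


section \<open>Vector bundles and modular forms\<close>

text \<open>
  A holomorphic vector bundle of rank \<open>CARD('g)\<close> is given by open covers \<open>nbh x i\<close> of the spaces of
  the diagram over which it is trivialised, and by transition matrices. For an arrow \<open>a : x \<rightarrow> y\<close>,
  \<open>trans a i k\<close> is the matrix, in the trivialisations over \<open>nbh x i\<close> and \<open>nbh y k\<close>, of the
  isomorphism from the pullback along \<open>a\<close> of the bundle on the space of \<open>y\<close> to the bundle on the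
  space of \<open>x\<close>. For identity arrows these are the usual transition matrices \<open>g\<^sub>i\<^sub>k\<close> of the bundle on
  a single space, and the cocycle condition reads \<open>g\<^sub>i\<^sub>l = g\<^sub>i\<^sub>k g\<^sub>k\<^sub>l\<close>. For a group \<open>\<Gamma>\<close> acting
  on \<open>D\<close>, \<open>trans \<gamma>\<close> is the inverse of the factor of automorphy \<open>j(\<gamma>, z)\<close>.
\<close>

record ('o, 'a, 'i, 'x, 'g, 'r) cocycle =
  idx :: "'o \<Rightarrow> 'i set"
  nbh :: "'o \<Rightarrow> 'i \<Rightarrow> 'x set"
  trans :: "'a \<Rightarrow> 'i \<Rightarrow> 'i \<Rightarrow> 'g \<Rightarrow> 'g \<Rightarrow> 'r"

definition overlap ::
    "('o, 'a, 'x, 'r) diagram \<Rightarrow> ('o, 'a, 'i, 'x, 'g, 'r) cocycle \<Rightarrow> 'a \<Rightarrow> 'i \<Rightarrow> 'i \<Rightarrow> 'x set" where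
  "overlap X E a i k =
    nbh E (src X a) i \<inter> preim (spc X (src X a)) (base_map X a) (nbh E (tgt X a) k)"

definition vector_bundle ::
    "('o, 'a, 'x, 'r) diagram \<Rightarrow> ('o, 'a, 'i, 'x, 'g::finite, 'r) cocycle \<Rightarrow> bool" where
  "vector_bundle X E \<longleftrightarrow>
    (\<forall>x\<in>objs X. (\<forall>i\<in>idx E x. openin (tops (spc X x)) (nbh E x i)) \<and>
        (\<Union>i\<in>idx E x. nbh E x i) = topspace (tops (spc X x))) \<and>
    (\<forall>a\<in>arrs X. \<forall>i\<in>idx E (src X a). \<forall>k\<in>idx E (tgt X a).
        trans E a i k \<in> ring_GL (secs (spc X (src X a)) (overlap X E a i k))
                                (cst (spc X (src X a)) (overlap X E a i k))) \<and>
    (\<forall>x\<in>objs X. \<forall>i\<in>idx E x. trans E (idn X x) i i =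
        (\<lambda>r s. if r = s then \<one>\<^bsub>secs (spc X x) (nbh E x i)\<^esub> else \<zero>\<^bsub>secs (spc X x) (nbh E x i)\<^esub>)) \<and>
    (\<forall>a b. composable X b a \<longrightarrow>
      (\<forall>i\<in>idx E (src X a). \<forall>k\<in>idx E (tgt X a). \<forall>l\<in>idx E (tgt X b).
        (let S = spc X (src X a); T = overlap X E a i k \<inter> overlap X E (cmp X b a) i l in
          (\<lambda>r s. res S (overlap X E (cmp X b a) i l) T (trans E (cmp X b a) i l r s)) =
          ring_mult_mat (secs S T)
            (\<lambda>r s. res S (overlap X E a i k) T (trans E a i k r s))
            (\<lambda>r s. res S (preim S (base_map X a) (overlap X E b k l)) T
                (pullback X a (overlap X E b k l) (trans E b k l r s))))))"

text \<open>
  A section is given by its components in the local trivialisations, which have to correspond under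
  the transition matrices; on a single space the condition is \<open>f\<^sub>i = g\<^sub>i\<^sub>k f\<^sub>k\<close>.
\<close>

definition bundle_section ::
    "('o, 'a, 'x, 'r) diagram \<Rightarrow> ('o, 'a, 'i, 'x, 'v::finite, 'r) cocycle \<Rightarrow>
     ('o \<Rightarrow> 'i \<Rightarrow> 'v \<Rightarrow> 'r) \<Rightarrow> bool" where
  "bundle_section X F f \<longleftrightarrow>
    (\<forall>x\<in>objs X. \<forall>i\<in>idx F x. \<forall>r. f x i r \<in> carrier (secs (spc X x) (nbh F x i))) \<and>
    (\<forall>a\<in>arrs X. \<forall>i\<in>idx F (src X a). \<forall>k\<in>idx F (tgt X a).
      (let S = spc X (src X a); T = overlap X F a i k in
        (\<lambda>r. res S (nbh F (src X a) i) T (f (src X a) i r)) =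
        ring_mult_vec (secs S T) (trans F a i k)
          (\<lambda>r. res S (preim S (base_map X a) (nbh F (tgt X a) k)) T
              (pullback X a (nbh F (tgt X a) k) (f (tgt X a) k r)))))"

text \<open>The bundle associated with the frame bundle of \<open>E\<close> via the representation \<open>\<rho>\<close>.\<close>

definition schur_bundle ::
    "('o, 'a, 'x, 'r) diagram \<Rightarrow> ('o, 'a, 'i, 'x, 'g::finite, 'r) cocycle \<Rightarrow>
     (complex^'g^'g \<Rightarrow> complex^'v^'v) \<Rightarrow> ('o, 'a, 'i, 'x, 'v, 'r) cocycle" where
  "schur_bundle X E \<rho> =
    \<lparr>idx = idx E, nbh = nbh E,
     trans = (\<lambda>a i k. rep_over (secs (spc X (src X a)) (overlap X E a i k))
                               (cst (spc X (src X a)) (overlap X E a i k)) \<rho> (trans E a i k))\<rparr>"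

definition modular_form ::
    "('o, 'a, 'x, 'r) diagram \<Rightarrow> ('o, 'a, 'i, 'x, 'g::finite, 'r) cocycle \<Rightarrow>
     (complex^'g^'g \<Rightarrow> complex^'v^'v) \<Rightarrow> ('o \<Rightarrow> 'i \<Rightarrow> 'v::finite \<Rightarrow> 'r) \<Rightarrow> bool" where
  "modular_form X E \<rho> f \<longleftrightarrow> bundle_section X (schur_bundle X E \<rho>) f"

text \<open>The image of \<open>f\<^sup>d\<close> under the bundle map induced by \<open>p\<close>.\<close>

definition apply_concomitant ::
    "('o, 'a, 'x, 'r) diagram \<Rightarrow> ('o, 'a, 'i, 'x, 'g::finite, 'r) cocycle \<Rightarrow> nat \<Rightarrow>
     ((('v::finite \<Rightarrow>\<^sub>0 nat) \<Rightarrow>\<^sub>0 complex) \<Rightarrow> complex^'w) \<Rightarrow>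
     ('o \<Rightarrow> 'i \<Rightarrow> 'v \<Rightarrow> 'r) \<Rightarrow> 'o \<Rightarrow> 'i \<Rightarrow> 'w \<Rightarrow> 'r" where
  "apply_concomitant X E d p f =
    (\<lambda>x i. let R = secs (spc X x) (nbh E x i); c = cst (spc X x) (nbh E x i) in
      proj_over R c d p (sym_power R d (f x i)))"

end

(*
  Trivialised over an algebra R of sections, the claim is an identity between polynomials in the
  entries of an invertible matrix A over R, its inverse determinant, and a vector v over R, namely
  p((rho(A) v)^d) = sigma(A) p(v^d). Over the complex numbers this is the equivariance of p. As a
  complex polynomial that vanishes at all complex points is zero, the identity persists over every
  commutative complex algebra. Restrictions and comorphisms are homomorphisms of complex algebras,
  so they commute with v |-> p(v^d), and the transition rule carries over.
*)
theory Submission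
  imports Defs
begin

section \<open>Commutative complex algebras\<close>

text \<open>The obstacle is the inverse determinant in \<open>rep_over\<close>: in the ring of
  polynomials in the matrix entries the determinant is not a unit, so the generic matrix does not
  lie in GL over that ring. Denominators are therefore cleared. If det^k and det^l make the two
  representations polynomial, the identity is multiplied by det^(k*d) and det^l; the exponent k*d
  appears because v^d is homogeneous of degree d in v. The cleared identity uses only ring
  operations and complex constants, so every homomorphism of complex algebras preserves both of its
  sides. It can thus be written once, with indeterminates as entries, and specialised both to
  complex points, where it is known, and to sections, where it is wanted. \<open>univ_ring\<close>
  turns a type-class ring into a record with full carrier. Complex numbers, polynomials and rings of
  sections then fall under the same definitions, and specialisation is a homomorphism between
  instances of one locale.\<close>

definition univ_ring :: "'a::comm_ring_1 ring" where
  "univ_ring = \<lparr>carrier = UNIV, mult = (*), one = 1, zero = 0, add = (+)\<rparr>"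

lemma univ_ring_simps [simp]:
  "carrier univ_ring = UNIV" "x \<otimes>\<^bsub>univ_ring\<^esub> y = x * y" "\<one>\<^bsub>univ_ring\<^esub> = 1"
  "\<zero>\<^bsub>univ_ring\<^esub> = 0" "x \<oplus>\<^bsub>univ_ring\<^esub> y = x + y"
  by (simp_all add: univ_ring_def)

interpretation univ_ring: cring "univ_ring :: 'a::comm_ring_1 ring"
proof -
  have "\<exists>y. x + y = 0" for x :: 'a
    using add.right_inverse by blast
  then show "cring (univ_ring :: 'a ring)"
    by unfold_locales (auto simp: algebra_simps Units_def)
qed

lemma complex_ring_eq: "complex_ring = univ_ring"
  by (simp add: complex_ring_def univ_ring_def)

lemma finsum_univ_ring [simp]:
  "finsum (univ_ring :: 'a::comm_ring_1 ring) f A = sum f A"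
  by (induction A rule: infinite_finite_induct) auto

lemma finprod_univ_ring [simp]:
  "finprod (univ_ring :: 'a::comm_ring_1 ring) f A = prod f A"
  by (induction A rule: infinite_finite_induct) auto

lemma pow_univ_ring [simp]:
  "x [^]\<^bsub>(univ_ring :: 'a::comm_ring_1 ring)\<^esub> (n::nat) = x ^ n"
  by (induction n) (auto simp: mult.commute)

lemma poly_mapping_sum_singles:
  fixes P :: "'a \<Rightarrow>\<^sub>0 'b::comm_monoid_add"
  shows "P = (\<Sum>m\<in>Poly_Mapping.keys P. Poly_Mapping.single m (Poly_Mapping.lookup P m))"
  by (intro poly_mapping_eqI)
     (auto simp: lookup_sum lookup_single when_def in_keys_iff)

lemma poly_mapping_single_add_induct [case_names zero single add]:
  fixes P :: "'a \<Rightarrow>\<^sub>0 'b::comm_monoid_add"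
  assumes "Q 0" "\<And>m a. Q (Poly_Mapping.single m a)" "\<And>P P'. Q P \<Longrightarrow> Q P' \<Longrightarrow> Q (P + P')"
  shows "Q P"
proof -
  have "Q (\<Sum>m\<in>K. Poly_Mapping.single m (Poly_Mapping.lookup P m))" for K
    by (induction K rule: infinite_finite_induct) (auto intro: assms)
  then show ?thesis by (subst poly_mapping_sum_singles)
qed

text \<open>Every exponent is bounded by the total degree, and there are finitely many variables.
  Hence \<open>proj_over\<close> is a genuine finite sum.\<close>

lemma finite_mdeg: "finite {m :: 'v::finite \<Rightarrow>\<^sub>0 nat. mdeg m = d}"
proof (rule finite_imageD)
  have *: "Poly_Mapping.lookup m i \<le> mdeg m" for m :: "'v \<Rightarrow>\<^sub>0 nat" and i
    unfolding mdeg_def by (rule member_le_sum) auto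
  have "Poly_Mapping.lookup ` {m :: 'v \<Rightarrow>\<^sub>0 nat. mdeg m = d} \<subseteq> Pi\<^sub>E UNIV (\<lambda>_. {..d})"
  proof (rule image_subsetI)
    fix m :: "'v \<Rightarrow>\<^sub>0 nat" assume "m \<in> {m. mdeg m = d}"
    then show "Poly_Mapping.lookup m \<in> Pi\<^sub>E UNIV (\<lambda>_. {..d})"
      using *[of m] by (simp add: PiE_UNIV_domain)
  qed
  moreover have "finite (Pi\<^sub>E (UNIV :: 'v set) (\<lambda>_. {..d}))"
    by (intro finite_PiE) auto
  ultimately show "finite (Poly_Mapping.lookup ` {m :: 'v \<Rightarrow>\<^sub>0 nat. mdeg m = d})"
    by (rule finite_subset)
  show "inj_on Poly_Mapping.lookup {m :: 'v \<Rightarrow>\<^sub>0 nat. mdeg m = d}"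
    by (rule inj_onI) (rule poly_mapping_eqI, simp)
qed

locale complex_algebra = cring R for R :: "'r ring" (structure) +
  fixes c :: "complex \<Rightarrow> 'r"
  assumes c_hom: "c \<in> ring_hom univ_ring R"
begin

sublocale c: ring_hom_cring univ_ring R c
  by unfold_locales (rule c_hom)

lemma c_closed [simp, intro]: "c z \<in> carrier R"
  using c.hom_closed by simp

lemma c_zero [simp]: "c 0 = \<zero>" and c_one [simp]: "c 1 = \<one>"
  and c_add: "c (x + y) = c x \<oplus> c y" and c_mult: "c (x * y) = c x \<otimes> c y"
  using c.hom_zero c.hom_one c.hom_add[of x y] c.hom_mult[of x y] by simp_all

lemma det_closed [simp, intro]:
  assumes "\<And>i j. A i j \<in> carrier R" shows "ring_det R c A \<in> carrier R"
  unfolding ring_det_def using assms by (auto intro!: finsum_closed finprod_closed m_closed)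

lemma mult_vec_closed [simp, intro]:
  assumes "\<And>i j. A i j \<in> carrier R" "\<And>j. v j \<in> carrier R"
  shows "ring_mult_vec R A v i \<in> carrier R"
  unfolding ring_mult_vec_def using assms by (auto intro!: finsum_closed)

lemma poly_eval_closed [simp, intro]:
  assumes "\<And>i. x i \<in> carrier R" shows "poly_eval R c x P \<in> carrier R"
  unfolding poly_eval_def using assms by (auto intro!: finsum_closed finprod_closed m_closed)

lemma sym_power_closed [simp, intro]:
  assumes "\<And>i. v i \<in> carrier R" shows "sym_power R d v m \<in> carrier R"
  unfolding sym_power_def using assms by (auto intro!: finsum_closed finprod_closed)

lemma proj_over_closed [simp, intro]:
  assumes "\<And>m. s m \<in> carrier R" shows "proj_over R c d p s i \<in> carrier R"
  unfolding proj_over_def using assms by (auto intro!: finsum_closed)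

text \<open>Terms outside the support vanish because \<open>c 0\<close> is zero. A common index set
  is needed to compare P, Q and P + Q, since cancellation can make the support of the sum smaller
  than the union.\<close>

lemma poly_eval_superset:
  assumes "\<And>i. x i \<in> carrier R" "finite K" "Poly_Mapping.keys P \<subseteq> K"
  shows "poly_eval R c x P = (\<Oplus>m\<in>K. c (Poly_Mapping.lookup P m) \<otimes>
           (\<Otimes>i\<in>UNIV. x i [^] Poly_Mapping.lookup m i))"
  unfolding poly_eval_def using assms
  by (intro add.finprod_mono_neutral_cong_left)
     (auto simp: in_keys_iff finprod_closed intro!: m_closed)

lemma poly_eval_add:
  fixes x :: "'i::finite \<Rightarrow> 'r"
  assumes "\<And>i. x i \<in> carrier R"
  shows "poly_eval R c x (P + Q) = poly_eval R c x P \<oplus> poly_eval R c x Q"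
proof -
  let ?K = "Poly_Mapping.keys P \<union> Poly_Mapping.keys Q"
  have M: "(\<Otimes>i\<in>UNIV. x i [^] Poly_Mapping.lookup m i) \<in> carrier R" for m :: "'i \<Rightarrow>\<^sub>0 nat"
    using assms by (auto intro!: finprod_closed)
  have "Poly_Mapping.keys (P + Q) \<subseteq> ?K" by (rule Poly_Mapping.keys_add)
  then show ?thesis
    using M by (simp add: poly_eval_superset[OF assms, of ?K] Pi_def lookup_add c_add l_distr)
qed

lemma poly_eval_single:
  assumes "\<And>i. x i \<in> carrier R"
  shows "poly_eval R c x (Poly_Mapping.single m a) =
           c a \<otimes> (\<Otimes>i\<in>UNIV. x i [^] Poly_Mapping.lookup m i)"
  using assms by (subst poly_eval_superset[of x "{m}"]) (auto simp: finprod_closed)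

lemma poly_eval_zero: "poly_eval R c x 0 = \<zero>"
  by (simp add: poly_eval_def)

lemma poly_eval_one:
  assumes "\<And>i. x i \<in> carrier R" shows "poly_eval R c x 1 = \<one>"
proof -
  have "poly_eval R c x (Poly_Mapping.single 0 1) = \<one>"
    using assms by (simp add: poly_eval_single del: single_one)
  then show ?thesis by simp
qed

lemma poly_eval_variable:
  assumes "\<And>i. x i \<in> carrier R"
  shows "poly_eval R c x (Poly_Mapping.single (Poly_Mapping.single i 1) 1) = x i"
proof -
  have "(\<Otimes>j\<in>UNIV. x j [^] Poly_Mapping.lookup (Poly_Mapping.single i (1::nat)) j) =
        (\<Otimes>j\<in>UNIV. if i = j then x j else \<one>)"
    using assms by (intro finprod_cong') (auto simp: lookup_single when_def)
  also have "\<dots> = x i"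
    using assms by (subst finprod_singleton) auto
  finally show ?thesis using assms by (simp add: poly_eval_single)
qed

lemma poly_eval_mult_single:
  fixes x :: "'i::finite \<Rightarrow> 'r"
  assumes "\<And>i. x i \<in> carrier R"
  shows "poly_eval R c x (Poly_Mapping.single m a * Poly_Mapping.single n b) =
    poly_eval R c x (Poly_Mapping.single m a) \<otimes> poly_eval R c x (Poly_Mapping.single n b)"
proof -
  have M: "(\<Otimes>i\<in>UNIV. x i [^] Poly_Mapping.lookup m i) \<in> carrier R" for m :: "'i \<Rightarrow>\<^sub>0 nat"
    using assms by (auto intro!: finprod_closed)
  have eq: "(\<Otimes>i\<in>UNIV. x i [^] Poly_Mapping.lookup (m + n) i) =
      (\<Otimes>i\<in>UNIV. x i [^] Poly_Mapping.lookup m i) \<otimes>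
      (\<Otimes>i\<in>UNIV. x i [^] Poly_Mapping.lookup n i)"
    using assms by (simp add: lookup_add nat_pow_mult[symmetric] Pi_def)
  show ?thesis
    unfolding mult_single poly_eval_single[OF assms] c_mult eq
    using M[of m] M[of n] by (simp only: m_ac c_closed m_closed)
qed

text \<open>Both sides are additive in P and in Q, so induction on each argument reduces the claim
  to two monomials, where exponents add.\<close>

lemma poly_eval_mult:
  assumes "\<And>i. x i \<in> carrier R"
  shows "poly_eval R c x (P * Q) = poly_eval R c x P \<otimes> poly_eval R c x Q"
proof (induction P rule: poly_mapping_single_add_induct)
  case (single m a)
  show ?case
  proof (induction Q rule: poly_mapping_single_add_induct)
    case (add Q Q')
    then show ?case
      by (simp only: distrib_left poly_eval_add[OF assms] r_distr poly_eval_closed[OF assms])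
  qed (use assms in \<open>simp_all add: poly_eval_zero poly_eval_mult_single\<close>)
next
  case (add P P')
  then show ?case
    by (simp only: distrib_right poly_eval_add[OF assms] l_distr poly_eval_closed[OF assms])
qed (use assms in \<open>simp_all add: poly_eval_zero\<close>)

lemma poly_eval_hom:
  assumes "\<And>i. x i \<in> carrier R"
  shows "poly_eval R c x \<in> ring_hom univ_ring R"
  using assms by (intro ring_hom_memI) (auto simp: poly_eval_mult poly_eval_add poly_eval_one)

section \<open>Homogeneity under scaling\<close>

lemma mult_vec_scale:
  assumes "u \<in> carrier R" "\<And>i j. A i j \<in> carrier R" "\<And>j. v j \<in> carrier R"
  shows "ring_mult_vec R (\<lambda>i j. u \<otimes> A i j) v i = u \<otimes> ring_mult_vec R A v i"
  unfolding ring_mult_vec_def using assms by (subst finsum_rdistr) (auto simp: m_assoc)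

text \<open>Each word of length d contributes d factors u. This is the homogeneity that turns a
  denominator det^k of the first representation into det^(k*d).\<close>

lemma sym_power_scale:
  fixes v :: "'v::finite \<Rightarrow> 'r"
  assumes "u \<in> carrier R" "\<And>j. v j \<in> carrier R"
  shows "sym_power R d (\<lambda>i. u \<otimes> v i) m = u [^] d \<otimes> sym_power R d v m"
proof -
  have "finite {l :: 'v list. length l = d \<and> sum_list (map (\<lambda>i. Poly_Mapping.single i 1) l) = m}"
    by (rule finite_subset[OF _ finite_lists_length_eq[of UNIV d]]) auto
  then show ?thesis
    unfolding sym_power_def using assms
    by (subst finsum_rdistr)
       (auto simp: finprod_multf Pi_def finprod_const finprod_closed intro!: finsum_cong')
qed

lemma proj_over_scale:
  assumes "u \<in> carrier R" "\<And>m. s m \<in> carrier R"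
  shows "proj_over R c d p (\<lambda>m. u \<otimes> s m) i = u \<otimes> proj_over R c d p s i"
proof -
  have "c z \<otimes> (u \<otimes> s m) = u \<otimes> (c z \<otimes> s m)" for z m
    using assms by (simp add: m_lcomm)
  then show ?thesis
    unfolding proj_over_def using assms by (subst finsum_rdistr) (simp_all add: finite_mdeg)
qed

end

section \<open>Naturality under homomorphisms of complex algebras: evaluations, restrictions and
  comorphisms\<close>

locale complex_algebra_hom = R: complex_algebra R c + S: complex_algebra S c'
  for R :: "'r ring" (structure) and c and S :: "'s ring" and c' +
  fixes h
  assumes h_hom: "h \<in> ring_hom R S" and h_c [simp]: "h (c z) = c' z"
begin

sublocale ring_hom_cring R S h
  by unfold_locales (rule h_hom)

lemma hom_pow:
  assumes "x \<in> carrier R" shows "h (x [^] (n::nat)) = h x [^]\<^bsub>S\<^esub> n"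
  using assms by (induction n) auto

lemma hom_mult_vec:
  assumes "\<And>i j. A i j \<in> carrier R" "\<And>j. v j \<in> carrier R"
  shows "h (ring_mult_vec R A v i) = ring_mult_vec S (\<lambda>i j. h (A i j)) (\<lambda>j. h (v j)) i"
  using assms by (simp add: ring_mult_vec_def Pi_def comp_def hom_finprod)

lemma hom_det:
  assumes "\<And>i j. A i j \<in> carrier R"
  shows "h (ring_det R c A) = ring_det S c' (\<lambda>i j. h (A i j))"
  using assms by (simp add: ring_det_def Pi_def comp_def hom_finprod R.finprod_closed cong: S.finsum_cong)

lemma hom_poly_eval:
  assumes "\<And>i. x i \<in> carrier R"
  shows "h (poly_eval R c x P) = poly_eval S c' (\<lambda>i. h (x i)) P"
  using assms by (simp add: poly_eval_def Pi_def comp_def hom_finprod R.finprod_closed hom_pow)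

lemma hom_sym_power:
  assumes "\<And>i. v i \<in> carrier R"
  shows "h (sym_power R d v m) = sym_power S d (\<lambda>i. h (v i)) m"
  using assms by (simp add: sym_power_def Pi_def comp_def hom_finprod R.finprod_closed)

lemma hom_proj_over:
  assumes "\<And>m. s m \<in> carrier R"
  shows "h (proj_over R c d p s i) = proj_over S c' d p (\<lambda>m. h (s m)) i"
  using assms by (simp add: proj_over_def Pi_def comp_def)

end

section \<open>Polynomial identities\<close>

lemma complex_algebra_complex: "complex_algebra (univ_ring :: complex ring) id"
  by unfold_locales simp

lemma complex_algebra_polynomials:
  "complex_algebra (univ_ring :: (('i \<Rightarrow>\<^sub>0 nat) \<Rightarrow>\<^sub>0 complex) ring) (Poly_Mapping.single 0)"
  by unfold_locales (auto intro!: ring_hom_memI simp: mult_single single_add)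

lemma (in complex_algebra) poly_eval_complex_algebra_hom:
  assumes "\<And>i. x i \<in> carrier R"
  shows "complex_algebra_hom univ_ring (Poly_Mapping.single 0) R c (poly_eval R c x)"
proof -
  interpret P: complex_algebra "univ_ring :: (('b \<Rightarrow>\<^sub>0 nat) \<Rightarrow>\<^sub>0 complex) ring" "Poly_Mapping.single 0"
    by (rule complex_algebra_polynomials)
  show ?thesis
    by unfold_locales (use assms in \<open>auto simp: poly_eval_hom poly_eval_single\<close>)
qed

text \<open>This is the Vandermonde argument: vanishing against all powers of \<open>a m\<close>
  extends linearly to vanishing against all polynomials in \<open>a m\<close>, and a suitable
  polynomial isolates one index.\<close>

lemma exponential_sums_independent:
  fixes a :: "'m \<Rightarrow> 'k::idom"
  assumes "finite K" "inj_on a K" "\<And>s. (\<Sum>m\<in>K. b m * a m ^ s) = 0" "m \<in> K"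
  shows "b m = 0"
proof -
  have *: "(\<Sum>m\<in>K. b m * poly r (a m)) = 0" for r
  proof -
    have "(\<Sum>m\<in>K. b m * poly r (a m)) = (\<Sum>m\<in>K. \<Sum>s\<le>degree r. coeff r s * (b m * a m ^ s))"
      by (simp add: poly_altdef sum_distrib_left mult_ac)
    also have "\<dots> = (\<Sum>s\<le>degree r. coeff r s * (\<Sum>m\<in>K. b m * a m ^ s))"
      by (subst sum.swap) (simp add: sum_distrib_left)
    finally show ?thesis by (simp add: assms(3))
  qed
  \<comment> \<open>The numerator of the Lagrange interpolation polynomial: it vanishes at every
    node except \<open>a m\<close>.\<close>
  define r where "r = (\<Prod>m'\<in>K - {m}. [:- a m', 1:])"
  have r: "poly r x = (\<Prod>m'\<in>K - {m}. x - a m')" for x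
    by (simp add: r_def poly_prod)
  have "0 = (\<Sum>m'\<in>K. b m' * poly r (a m'))" by (simp add: *)
  also have "\<dots> = (\<Sum>m'\<in>{m}. b m' * poly r (a m'))"
    using assms by (intro sum.mono_neutral_right) (auto simp: r)
  finally have "b m * (\<Prod>m'\<in>K - {m}. a m - a m') = 0" by (simp add: r)
  moreover have "(\<Prod>m'\<in>K - {m}. a m - a m') \<noteq> 0"
    using assms by (auto simp: inj_on_def)
  ultimately show ?thesis by simp
qed

lemma ex_inj_to_primes: "\<exists>q :: 'i::finite \<Rightarrow> nat. inj q \<and> (\<forall>i. prime (q i))"
proof -
  obtain e :: "'i \<Rightarrow> nat" where e: "inj e"
    using finite_imp_inj_to_nat_seg[of "UNIV :: 'i set"] by auto
  obtain f :: "nat \<Rightarrow> nat" where f: "inj f" "range f \<subseteq> {p. prime p}"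
    using infinite_countable_subset[OF primes_infinite] by auto
  show ?thesis
    using inj_compose[OF f(1) e] f(2) by (intro exI[of _ "f \<circ> e"]) auto
qed

text \<open>
  Substituting \<open>x\<^sub>i = q\<^sub>i\<^sup>s\<close> for distinct primes \<open>q\<^sub>i\<close> turns distinct monomials into powers of distinct
  integers, and these are linearly independent as functions of \<open>s\<close>.
\<close>

lemma polynomial_vanishing_everywhere:
  fixes P :: "('i::finite \<Rightarrow>\<^sub>0 nat) \<Rightarrow>\<^sub>0 complex"
  assumes "\<And>x. poly_eval univ_ring id x P = 0"
  shows "P = 0"
proof -
  obtain q :: "'i \<Rightarrow> nat" where q: "inj q" "\<And>i. prime (q i)"
    using ex_inj_to_primes by blast
  define a where "a m = (\<Prod>i\<in>UNIV. q i ^ Poly_Mapping.lookup m i)" for m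
  \<comment> \<open>Unique factorisation: the exponents of a monomial can be read off from the
    integer \<open>a m\<close>, so \<open>a\<close> is injective.\<close>
  have "multiplicity (q j) (a m) = Poly_Mapping.lookup m j" for m j
  proof -
    have "a m = (\<Prod>p\<in>range q. p ^ Poly_Mapping.lookup m (inv_into UNIV q p))"
      using q(1) by (simp add: a_def prod.reindex)
    also have "multiplicity (q j) \<dots> = Poly_Mapping.lookup m j"
      using q by (subst multiplicity_prod_prime_powers) auto
    finally show ?thesis .
  qed
  then have inj: "inj a"
    by (intro injI poly_mapping_eqI) metis
  have eval: "poly_eval univ_ring id (\<lambda>i. of_nat (q i) ^ s) P =
      (\<Sum>m\<in>Poly_Mapping.keys P. Poly_Mapping.lookup P m * of_nat (a m) ^ s)" for s
  proof -
    have "(\<Prod>i\<in>UNIV. (of_nat (q i) ^ s) ^ Poly_Mapping.lookup m i) = (of_nat (a m) ^ s :: complex)"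
      for m
      by (simp add: a_def prod_power_distrib power_mult[symmetric] mult.commute)
    then show ?thesis by (simp add: poly_eval_def)
  qed
  show ?thesis
  proof (rule poly_mapping_eqI, rule ccontr)
    fix m assume "Poly_Mapping.lookup P m \<noteq> Poly_Mapping.lookup 0 m"
    then have m: "m \<in> Poly_Mapping.keys P" and "Poly_Mapping.lookup P m \<noteq> 0"
      by (simp_all add: in_keys_iff)
    moreover have "Poly_Mapping.lookup P m = 0"
    proof (rule exponential_sums_independent[OF _ _ _ m])
      show "inj_on (\<lambda>m. of_nat (a m) :: complex) (Poly_Mapping.keys P)"
        using inj by (auto intro!: inj_onI dest: injD)
      show "(\<Sum>m\<in>Poly_Mapping.keys P. Poly_Mapping.lookup P m * of_nat (a m) ^ s) = 0" for s
        by (subst eval[symmetric]) (rule assms)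
    qed simp
    ultimately show False by simp
  qed
qed

section \<open>Equivariance over complex algebras\<close>

text \<open>
  Here \<open>P\<close> and \<open>Q\<close> are polynomial matrices for \<open>det\<^sup>k \<rho>\<close> and \<open>det\<^sup>l \<sigma>\<close>; the common denominator
  \<open>det\<^sup>k\<^sup>d det\<^sup>l\<close> is cleared, so that both sides are polynomials in the entries of \<open>A\<close> and \<open>v\<close>.
\<close>

definition equivariance_lhs ::
    "'r ring \<Rightarrow> (complex \<Rightarrow> 'r) \<Rightarrow> nat \<Rightarrow> ((('v::finite \<Rightarrow>\<^sub>0 nat) \<Rightarrow>\<^sub>0 complex) \<Rightarrow> complex^'w) \<Rightarrow>
     ('v \<Rightarrow> 'v \<Rightarrow> (('g::finite \<times> 'g) \<Rightarrow>\<^sub>0 nat) \<Rightarrow>\<^sub>0 complex) \<Rightarrow> nat \<Rightarrow>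
     ('g \<Rightarrow> 'g \<Rightarrow> 'r) \<Rightarrow> ('v \<Rightarrow> 'r) \<Rightarrow> 'w \<Rightarrow> 'r" where
  "equivariance_lhs R c d p P l A v r =
    ring_det R c A [^]\<^bsub>R\<^esub> l \<otimes>\<^bsub>R\<^esub> proj_over R c d p (sym_power R d
      (ring_mult_vec R (\<lambda>i j. poly_eval R c (\<lambda>(a, b). A a b) (P i j)) v)) r"

definition equivariance_rhs ::
    "'r ring \<Rightarrow> (complex \<Rightarrow> 'r) \<Rightarrow> nat \<Rightarrow> ((('v::finite \<Rightarrow>\<^sub>0 nat) \<Rightarrow>\<^sub>0 complex) \<Rightarrow> complex^'w) \<Rightarrow>
     ('w::finite \<Rightarrow> 'w \<Rightarrow> (('g::finite \<times> 'g) \<Rightarrow>\<^sub>0 nat) \<Rightarrow>\<^sub>0 complex) \<Rightarrow> nat \<Rightarrow>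
     ('g \<Rightarrow> 'g \<Rightarrow> 'r) \<Rightarrow> ('v \<Rightarrow> 'r) \<Rightarrow> 'w \<Rightarrow> 'r" where
  "equivariance_rhs R c d p Q k A v r =
    ring_det R c A [^]\<^bsub>R\<^esub> (k * d) \<otimes>\<^bsub>R\<^esub>
      ring_mult_vec R (\<lambda>i j. poly_eval R c (\<lambda>(a, b). A a b) (Q i j))
        (proj_over R c d p (sym_power R d v)) r"

lemma (in complex_algebra) equivariance_sides_closed:
  assumes "\<And>a b. A a b \<in> carrier R" "\<And>j. v j \<in> carrier R"
  shows "equivariance_lhs R c d p P l A v r \<in> carrier R"
    and "equivariance_rhs R c d p Q k A v r \<in> carrier R"
  unfolding equivariance_lhs_def equivariance_rhs_def using assms
  by (auto intro!: m_closed nat_pow_closed det_closed proj_over_closed sym_power_closed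
      mult_vec_closed poly_eval_closed)

text \<open>With the denominators cleared, both sides are built from sums, products and the
  structure map alone; no inverse occurs that a homomorphism would have to preserve.\<close>

lemma (in complex_algebra_hom) hom_equivariance_sides:
  assumes A: "\<And>a b. A a b \<in> carrier R" and v: "\<And>j. v j \<in> carrier R"
  shows "h (equivariance_lhs R c d p P l A v r) =
           equivariance_lhs S c' d p P l (\<lambda>a b. h (A a b)) (\<lambda>j. h (v j)) r" (is ?lhs)
    and "h (equivariance_rhs R c d p Q k A v r) =
           equivariance_rhs S c' d p Q k (\<lambda>a b. h (A a b)) (\<lambda>j. h (v j)) r" (is ?rhs)
proof -
  have A': "(case i of (a, b) \<Rightarrow> A a b) \<in> carrier R" for i
    using A by (cases i) auto
  have eval: "h (poly_eval R c (\<lambda>(a, b). A a b) F) = poly_eval S c' (\<lambda>(a, b). h (A a b)) F" for F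
    by (subst hom_poly_eval) (use A' in \<open>auto simp: case_prod_unfold\<close>)
  have PA: "poly_eval R c (\<lambda>(a, b). A a b) F \<in> carrier R" for F
    using A' by (rule R.poly_eval_closed)
  show ?lhs
    unfolding equivariance_lhs_def
    by (simp only: hom_mult hom_pow R.nat_pow_closed R.det_closed R.proj_over_closed
        R.sym_power_closed R.mult_vec_closed PA A v hom_det hom_proj_over hom_sym_power
        hom_mult_vec eval)
  show ?rhs
    unfolding equivariance_rhs_def
    by (simp only: hom_mult hom_pow R.nat_pow_closed R.det_closed R.proj_over_closed
        R.sym_power_closed R.mult_vec_closed PA A v hom_det hom_proj_over hom_sym_power
        hom_mult_vec eval)
qed

section \<open>The generic matrix and vector, and their specialisation\<close>

lemma ring_det_complex: "ring_det univ_ring id (\<lambda>a b. A $ a $ b) = det A"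
  by (simp add: ring_det_def det_def)

text \<open>The matrix and the vector need independent indeterminates in one polynomial ring, hence
  the sum type: \<open>Inl\<close> labels the matrix entries and \<open>Inr\<close> the vector
  coordinates.\<close>

definition generic_matrix ::
    "'g \<Rightarrow> 'g \<Rightarrow> (('g \<times> 'g + 'v) \<Rightarrow>\<^sub>0 nat) \<Rightarrow>\<^sub>0 complex" where
  "generic_matrix a b = Poly_Mapping.single (Poly_Mapping.single (Inl (a, b)) 1) 1"

definition generic_vector :: "'v \<Rightarrow> (('g \<times> 'g + 'v) \<Rightarrow>\<^sub>0 nat) \<Rightarrow>\<^sub>0 complex" where
  "generic_vector j = Poly_Mapping.single (Poly_Mapping.single (Inr j) 1) 1"

context complex_algebra
begin

text \<open>Evaluation at the entries of A and v is the homomorphism sending the generic pair to (A,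
  v), so naturality applies to each expression.\<close>

lemma specialise_generic:
  fixes A :: "'g::finite \<Rightarrow> 'g \<Rightarrow> 'r" and v :: "'v::finite \<Rightarrow> 'r"
  assumes A: "\<And>a b. A a b \<in> carrier R" and v: "\<And>j. v j \<in> carrier R"
  shows "poly_eval R c (case_sum (\<lambda>(a, b). A a b) v)
           (ring_det univ_ring (Poly_Mapping.single 0) generic_matrix) = ring_det R c A"
    and "poly_eval R c (case_sum (\<lambda>(a, b). A a b) v)
           (equivariance_lhs univ_ring (Poly_Mapping.single 0) d p P l generic_matrix generic_vector r)
         = equivariance_lhs R c d p P l A v r"
    and "poly_eval R c (case_sum (\<lambda>(a, b). A a b) v)
           (equivariance_rhs univ_ring (Poly_Mapping.single 0) d p Q k generic_matrix generic_vector r)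
         = equivariance_rhs R c d p Q k A v r"
proof -
  have closed: "case_sum (\<lambda>(a, b). A a b) v i \<in> carrier R" for i
    using A v by (auto split: sum.split)
  interpret complex_algebra_hom univ_ring "Poly_Mapping.single 0" R c
      "poly_eval R c (case_sum (\<lambda>(a, b). A a b) v)"
    using closed by (rule poly_eval_complex_algebra_hom)
  have *: "poly_eval R c (case_sum (\<lambda>(a, b). A a b) v) (generic_matrix a b) = A a b"
    "poly_eval R c (case_sum (\<lambda>(a, b). A a b) v) (generic_vector j) = v j" for a b j
    using poly_eval_variable[of "case_sum (\<lambda>(a, b). A a b) v" "Inl (a, b)", OF closed]
      poly_eval_variable[of "case_sum (\<lambda>(a, b). A a b) v" "Inr j", OF closed]
    by (simp_all only: generic_matrix_def generic_vector_def sum.case prod.case)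
  show "poly_eval R c (case_sum (\<lambda>(a, b). A a b) v)
           (ring_det univ_ring (Poly_Mapping.single 0) generic_matrix) = ring_det R c A"
    by (subst hom_det) (simp_all only: * univ_ring_simps UNIV_I)
  show "poly_eval R c (case_sum (\<lambda>(a, b). A a b) v)
           (equivariance_lhs univ_ring (Poly_Mapping.single 0) d p P l generic_matrix generic_vector r)
         = equivariance_lhs R c d p P l A v r"
    by (subst hom_equivariance_sides) (simp_all only: * univ_ring_simps UNIV_I)
  show "poly_eval R c (case_sum (\<lambda>(a, b). A a b) v)
           (equivariance_rhs univ_ring (Poly_Mapping.single 0) d p Q k generic_matrix generic_vector r)
         = equivariance_rhs R c d p Q k A v r"
    by (subst hom_equivariance_sides) (simp_all only: * univ_ring_simps UNIV_I)
qed

end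

text \<open>
  Multiplying both sides by the determinant makes them agree also at the complex matrices that are
  not invertible, and over \<open>R\<close> the determinant cancels.
\<close>

lemma (in complex_algebra) permanence_of_equivariance:
  fixes P :: "'v::finite \<Rightarrow> 'v \<Rightarrow> (('g::finite \<times> 'g) \<Rightarrow>\<^sub>0 nat) \<Rightarrow>\<^sub>0 complex"
    and Q :: "'w::finite \<Rightarrow> 'w \<Rightarrow> (('g \<times> 'g) \<Rightarrow>\<^sub>0 nat) \<Rightarrow>\<^sub>0 complex"
  assumes complex: "\<And>A v r. invertible A \<Longrightarrow>
      equivariance_lhs univ_ring id d p P l (\<lambda>a b. A $ a $ b) v r =
      equivariance_rhs univ_ring id d p Q k (\<lambda>a b. A $ a $ b) v r"
    and A: "A \<in> ring_GL R c" and v: "\<And>j. v j \<in> carrier R"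
  shows "equivariance_lhs R c d p P l A v r = equivariance_rhs R c d p Q k A v r"
proof -
  let ?D = "ring_det univ_ring (Poly_Mapping.single 0) generic_matrix ::
    ('g \<times> 'g + 'v \<Rightarrow>\<^sub>0 nat) \<Rightarrow>\<^sub>0 complex"
  let ?L = "equivariance_lhs univ_ring (Poly_Mapping.single 0) d p P l generic_matrix generic_vector r"
  let ?M = "equivariance_rhs univ_ring (Poly_Mapping.single 0) d p Q k generic_matrix generic_vector r"
  have "?D * ?L - ?D * ?M = 0"
  proof (rule polynomial_vanishing_everywhere)
    fix x :: "'g \<times> 'g + 'v \<Rightarrow> complex"
    interpret C: complex_algebra "univ_ring :: complex ring" id
      by (rule complex_algebra_complex)
    interpret h: complex_algebra_hom univ_ring "Poly_Mapping.single 0" univ_ring id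
        "poly_eval univ_ring id x"
      by (rule C.poly_eval_complex_algebra_hom) simp
    define B :: "complex^'g^'g" where "B = (\<chi> a b. x (Inl (a, b)))"
    define w where "w j = x (Inr j)" for j
    have x: "x = case_sum (\<lambda>(a, b). B $ a $ b) w"
      by (auto simp: fun_eq_iff B_def w_def split: sum.split)
    have "poly_eval univ_ring id x (?D * ?L) = poly_eval univ_ring id x (?D * ?M)"
    proof (cases "invertible B")
      case True
      then show ?thesis
        using complex[OF True, of w r]
        by (simp add: C.poly_eval_mult) (simp add: x C.specialise_generic)
    next
      case False
      then have "det B = 0" by (simp add: invertible_det_nz)
      then have "poly_eval univ_ring id x ?D = 0"
        by (simp add: x C.specialise_generic ring_det_complex)
      then show ?thesis by (simp add: C.poly_eval_mult)
    qed
    \<comment> \<open>Additivity of evaluation is available for sums, so the value of the difference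
      is found by adding \<open>?D * ?M\<close> back.\<close>
    moreover have "poly_eval univ_ring id x (?D * ?L) =
        poly_eval univ_ring id x (?D * ?L - ?D * ?M) + poly_eval univ_ring id x (?D * ?M)"
      using C.poly_eval_add[of x "?D * ?L - ?D * ?M" "?D * ?M"] by simp
    ultimately show "poly_eval univ_ring id x (?D * ?L - ?D * ?M) = 0" by simp
  qed
  then have eq: "?D * ?L = ?D * ?M" by simp
  have closed: "A a b \<in> carrier R" for a b
    using A by (simp add: ring_GL_def)
  have D: "ring_det R c A \<in> Units R"
    using A by (simp add: ring_GL_def)
  have x: "case_sum (\<lambda>(a, b). A a b) v i \<in> carrier R" for i
    using closed v by (auto split: sum.split)
  have "ring_det R c A \<otimes> equivariance_lhs R c d p P l A v r =
      ring_det R c A \<otimes> equivariance_rhs R c d p Q k A v r"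
    using arg_cong[OF eq, of "poly_eval R c (case_sum (\<lambda>(a, b). A a b) v)"]
    by (simp only: poly_eval_mult[OF x] specialise_generic[OF closed v])
  then show ?thesis
    using D equivariance_sides_closed(1)[of A v d p P l r, OF closed v]
      equivariance_sides_closed(2)[of A v d p Q k r, OF closed v]
    by (simp add: Units_l_cancel)
qed

section \<open>Equivariance over the complex numbers\<close>

text \<open>Expanding over words instead of multisets avoids multinomial coefficients and matches
  the shape of \<open>sym_power\<close>.\<close>

lemma power_sum_words:
  fixes a :: "'v::finite \<Rightarrow> 'a::comm_semiring_1"
  shows "(\<Sum>i\<in>UNIV. a i) ^ d = (\<Sum>l\<in>{l. length l = d}. prod_list (map a l))"
proof (induction d)
  case (Suc d)
  have "{l :: 'v list. length l = Suc d} = (\<lambda>(i, l). i # l) ` (UNIV \<times> {l. length l = d})"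
    by (auto simp: image_iff length_Suc_conv)
  moreover have "inj_on (\<lambda>(i, l). i # l) (UNIV \<times> {l :: 'v list. length l = d})"
    by (auto simp: inj_on_def)
  ultimately show ?case
    by (simp add: Suc sum.reindex sum_product sum.cartesian_product case_prod_unfold)
qed simp

lemma prod_list_single:
  "prod_list (map (\<lambda>i. Poly_Mapping.single (e i) (b i :: 'b::comm_semiring_1)) l) =
   Poly_Mapping.single (sum_list (map e l)) (prod_list (map b l))"
  for e :: "'a \<Rightarrow> 'c::comm_monoid_add"
  by (induction l) (simp_all add: mult_single)

lemma prod_list_nth: "prod_list (map b l) = (\<Prod>k<length l. b (l ! k))"
  for b :: "'a \<Rightarrow> 'b::comm_monoid_mult"
  by (simp add: prod.list_conv_set_nth atLeast0LessThan)

text \<open>Each word yields the monomial that counts its letters; collecting the words with the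
  same monomial gives \<open>sym_power\<close>. This identifies it with the true power in the
  symmetric algebra.\<close>

lemma lookup_linear_form_power:
  "Poly_Mapping.lookup (linear_form v ^ d) = sym_power univ_ring d (($) v)"
proof
  fix m
  have "finite {l :: 'a list. length l = d}"
    using finite_lists_length_eq[of "UNIV :: 'a set" d] by simp
  then show "Poly_Mapping.lookup (linear_form v ^ d) m = sym_power univ_ring d (($) v) m"
    unfolding linear_form_def power_sum_words prod_list_single sym_power_def
    by (simp add: lookup_sum lookup_single when_def sum.If_cases prod_list_nth Int_def conj_commute)
qed

lemma mdeg_sum_list: "mdeg (sum_list (map (\<lambda>i. Poly_Mapping.single i 1) l)) = length l"
proof (induction l)
  case (Cons a l)
  have "mdeg (Poly_Mapping.single a 1 + m) = Suc (mdeg m)" for m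
    by (simp add: mdeg_def lookup_add sum.distrib lookup_single when_def)
  then show ?case using Cons by simp
qed (simp add: mdeg_def)

lemma linear_form_power_in_Sym:
  fixes v :: "complex^'v"
  shows "linear_form v ^ d \<in> Sym d"
proof -
  have "mdeg m = d" if "m \<in> Poly_Mapping.keys (linear_form v ^ d)" for m
  proof -
    let ?S = "{l. length l = d \<and> sum_list (map (\<lambda>i. Poly_Mapping.single i 1) l) = m}"
    have "(\<Sum>l\<in>?S. \<Prod>k<d. v $ (l ! k)) \<noteq> 0"
      using that by (simp only: in_keys_iff lookup_linear_form_power sym_power_def
          finsum_univ_ring finprod_univ_ring not_False_eq_True)
    \<comment> \<open>A nonzero sum has a nonzero term, so some word of length d has monomial m, and
      the degree of m is the length of that word.\<close>
    then obtain l where "l \<in> ?S"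
      by (meson sum.not_neutral_contains_not_neutral)
    then show ?thesis using mdeg_sum_list[of l] by simp
  qed
  then show ?thesis by (simp add: Sym_def)
qed

lemma sscale_single: "sscale z (Poly_Mapping.single m a) = Poly_Mapping.single m (z * a)"
  by (simp add: sscale_def mult_single)

lemma poly_mapping_single_sum:
  "Poly_Mapping.single m (\<Sum>i\<in>I. a i) = (\<Sum>i\<in>I. Poly_Mapping.single m (a i))"
  by (induction I rule: infinite_finite_induct) (simp_all add: single_add)

text \<open>\<open>sym_map M\<close> is the evaluation of polynomials at the linear forms of the
  columns of M, hence an algebra endomorphism. It commutes with powers, and only degree 1 has to be
  computed.\<close>

lemma sym_map_linear_form_power:
  fixes M :: "complex^'v^'v"
  shows "sym_map M (linear_form w ^ d) = linear_form (M *v w) ^ d"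
proof -
  let ?h = "poly_eval univ_ring (Poly_Mapping.single 0) (\<lambda>j. linear_form (column j M))"
  interpret P: complex_algebra "univ_ring :: (('v \<Rightarrow>\<^sub>0 nat) \<Rightarrow>\<^sub>0 complex) ring" "Poly_Mapping.single 0"
    by (rule complex_algebra_polynomials)
  interpret h: complex_algebra_hom univ_ring "Poly_Mapping.single 0" univ_ring
      "Poly_Mapping.single 0" ?h
    by (rule P.poly_eval_complex_algebra_hom) simp
  have sum: "?h (\<Sum>i\<in>I. F i) = (\<Sum>i\<in>I. ?h (F i))" for F :: "'b \<Rightarrow> _" and I
    using h.hom_finsum[of F I] by (simp add: comp_def)
  have "sym_map M P = ?h P" for P
    by (simp add: sym_map_def sscale_def poly_eval_def)
  moreover have "?h (linear_form w) = linear_form (M *v w)"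
  proof -
    have "?h (Poly_Mapping.single (Poly_Mapping.single j 1) (w $ j)) =
        Poly_Mapping.single 0 (w $ j) * linear_form (column j M)" for j
    proof -
      have "?h (Poly_Mapping.single (Poly_Mapping.single j 1) (w $ j)) =
          ?h (Poly_Mapping.single 0 (w $ j) * Poly_Mapping.single (Poly_Mapping.single j 1) 1)"
        by (simp add: mult_single)
      also have "\<dots> = ?h (Poly_Mapping.single 0 (w $ j)) *
          ?h (Poly_Mapping.single (Poly_Mapping.single j 1) 1)"
        by (subst P.poly_eval_mult) simp_all
      also have "?h (Poly_Mapping.single 0 (w $ j)) = Poly_Mapping.single 0 (w $ j)"
        by (rule h.h_c)
      also have "?h (Poly_Mapping.single (Poly_Mapping.single j 1) 1) = linear_form (column j M)"
        by (rule P.poly_eval_variable) simp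
      finally show ?thesis .
    qed
    then have "?h (linear_form w) =
        (\<Sum>j\<in>UNIV. Poly_Mapping.single 0 (w $ j) * linear_form (column j M))"
      by (simp only: linear_form_def[of w] sum)
    also have "\<dots> = (\<Sum>j\<in>UNIV. \<Sum>i\<in>UNIV.
        Poly_Mapping.single (Poly_Mapping.single i 1) (M $ i $ j * w $ j))"
      by (simp add: linear_form_def sum_distrib_left mult_single column_def mult.commute)
    also have "\<dots> = (\<Sum>i\<in>UNIV. \<Sum>j\<in>UNIV.
        Poly_Mapping.single (Poly_Mapping.single i 1) (M $ i $ j * w $ j))"
      by (rule sum.swap)
    also have "\<dots> = linear_form (M *v w)"
      by (simp add: linear_form_def matrix_vector_mult_def poly_mapping_single_sum)
    finally show ?thesis .
  qed
  moreover have "?h (linear_form w ^ d) = ?h (linear_form w) ^ d"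
    using h.hom_pow[of "linear_form w" d] by simp
  ultimately show ?thesis by simp
qed

section \<open>Comparison of the coefficient formula with the given projection\<close>

lemma proj_over_eq_projection:
  assumes p: "equivariant_projection d \<rho> \<sigma> \<phi> p" and P: "P \<in> Sym d"
  shows "proj_over univ_ring id d p (Poly_Mapping.lookup P) r = p P $ r"
proof -
  have add: "p (P + Q) = p P + p Q" if "P \<in> Sym d" "Q \<in> Sym d" for P Q
    using p that by (auto simp: equivariant_projection_def)
  have scale: "p (sscale z P) = z *s p P" if "P \<in> Sym d" for z P
    using p that by (auto simp: equivariant_projection_def)
  have zero: "p 0 = 0"
    using scale[of 0 0] by (simp add: sscale_def Sym_def)
  have single: "Poly_Mapping.single m a \<in> Sym d" if "mdeg m = d" for m :: "'b \<Rightarrow>\<^sub>0 nat" and a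
    using that by (simp add: Sym_def)
  have plus: "P + Q \<in> Sym d" if "P \<in> Sym d" "Q \<in> Sym d" for P Q
    using that Poly_Mapping.keys_add[of P Q] by (auto simp: Sym_def)
  \<comment> \<open>Since \<open>p\<close> is linear only on \<open>Sym d\<close>, membership of the
    partial sums must be carried through the induction together with additivity.\<close>
  have sum: "(\<Sum>m\<in>K. F m) \<in> Sym d \<and> p (\<Sum>m\<in>K. F m) = (\<Sum>m\<in>K. p (F m))"
    if "\<And>m. m \<in> K \<Longrightarrow> F m \<in> Sym d" for K and F :: "('b \<Rightarrow>\<^sub>0 nat) \<Rightarrow> _"
    using that
  proof (induction K rule: infinite_finite_induct)
    case (insert m K)
    then show ?case by (simp add: add plus)
  qed (simp_all add: zero Sym_def)
  have deg: "mdeg m = d" if "m \<in> Poly_Mapping.keys P" for m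
    using P that by (auto simp: Sym_def)
  have "p P = (\<Sum>m\<in>Poly_Mapping.keys P. p (Poly_Mapping.single m (Poly_Mapping.lookup P m)))"
    using sum[of "Poly_Mapping.keys P" "\<lambda>m. Poly_Mapping.single m (Poly_Mapping.lookup P m)",
        OF single[OF deg]]
    by (simp add: poly_mapping_sum_singles[symmetric])
  also have "\<dots> = (\<Sum>m\<in>Poly_Mapping.keys P. Poly_Mapping.lookup P m *s p (Poly_Mapping.single m 1))"
  proof (intro sum.cong refl)
    fix m assume "m \<in> Poly_Mapping.keys P"
    then show "p (Poly_Mapping.single m (Poly_Mapping.lookup P m)) =
        Poly_Mapping.lookup P m *s p (Poly_Mapping.single m 1)"
      using scale[OF single[OF deg], of m "Poly_Mapping.lookup P m" 1] by (simp add: sscale_single)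
  qed
  finally have "p P $ r =
      (\<Sum>m\<in>Poly_Mapping.keys P. Poly_Mapping.lookup P m * p (Poly_Mapping.single m 1) $ r)"
    by simp
  also have "\<dots> = (\<Sum>m\<in>{m. mdeg m = d}. Poly_Mapping.lookup P m * p (Poly_Mapping.single m 1) $ r)"
    by (rule sum.mono_neutral_left) (auto simp: finite_mdeg deg in_keys_iff)
  finally show ?thesis by (simp add: proj_over_def mult.commute)
qed

text \<open>Replacing the polynomials by \<open>det A ^ k * \<rho> A\<close> and
  \<open>det A ^ l * \<sigma> A\<close> and using homogeneity, both sides become det^(k*d) det^l
  times one and the same vector, by equivariance of \<open>p\<close> at w^d.\<close>

lemma equivariance_complex:
  assumes p: "equivariant_projection d \<rho> \<sigma> \<phi> p"
    and P: "rational_coeffs \<rho> k P" and Q: "rational_coeffs \<sigma> l Q" and A: "invertible A"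
  shows "equivariance_lhs univ_ring id d p P l (\<lambda>a b. A $ a $ b) v r =
         equivariance_rhs univ_ring id d p Q k (\<lambda>a b. A $ a $ b) v r"
proof -
  interpret C: complex_algebra "univ_ring :: complex ring" id
    by (rule complex_algebra_complex)
  let ?N = "\<lambda>v. proj_over univ_ring id d p (sym_power univ_ring d v)"
  have N: "?N (($) w) r = p (linear_form w ^ d) $ r" for w r
    by (simp add: proj_over_eq_projection[OF p linear_form_power_in_Sym]
        flip: lookup_linear_form_power)
  have N_scale: "?N (\<lambda>i. u * v i) r = u ^ d * ?N v r" for u v r
  proof -
    have "sym_power univ_ring d (\<lambda>i. u * v i) = (\<lambda>m. u ^ d * sym_power univ_ring d v m)"
      using C.sym_power_scale[of u v d] by (intro ext) simp
    then show ?thesis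
      using C.proj_over_scale[of "u ^ d" "sym_power univ_ring d v" d p r] by simp
  qed
  have scaled: "ring_mult_vec univ_ring (\<lambda>i j. z * M $ i $ j) w = (\<lambda>i. z * (M *v (\<chi> j. w j)) $ i)"
    for z and M :: "complex^'n^'n" and w
    by (simp add: ring_mult_vec_def matrix_vector_mult_def sum_distrib_left mult.assoc)
  define w where "w = (\<chi> j. v j)"
  have v: "v = ($) w" by (simp add: w_def fun_eq_iff)
  have "?N (($) (\<rho> A *v w)) = ($) (\<sigma> A *v (\<chi> r. ?N v r))"
  proof
    fix r
    have "p (linear_form (\<rho> A *v w) ^ d) = p (sym_map (\<rho> A) (linear_form w ^ d))"
      by (simp add: sym_map_linear_form_power)
    also have "\<dots> = \<sigma> A *v p (linear_form w ^ d)"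
      using p A linear_form_power_in_Sym[of w d] by (auto simp: equivariant_projection_def)
    also have "p (linear_form w ^ d) = (\<chi> r. ?N v r)"
      by (simp add: vec_eq_iff v N)
    finally show "?N (($) (\<rho> A *v w)) r = (\<sigma> A *v (\<chi> r. ?N v r)) $ r"
      by (simp add: N)
  qed
  moreover have "(\<lambda>i j. poly_eval univ_ring id (\<lambda>(a, b). A $ a $ b) (P i j)) =
      (\<lambda>i j. det A ^ k * \<rho> A $ i $ j)"
    "(\<lambda>i j. poly_eval univ_ring id (\<lambda>(a, b). A $ a $ b) (Q i j)) =
      (\<lambda>i j. det A ^ l * \<sigma> A $ i $ j)"
    using P Q A by (simp_all add: rational_coeffs_def complex_ring_eq)
  ultimately show ?thesis
    by (simp add: equivariance_lhs_def equivariance_rhs_def ring_det_complex scaled N_scale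
        w_def[symmetric] power_mult)
qed

text \<open>Here the denominators return: over R the determinant is a unit, so the cleared identity
  can be divided by det^(k*d) and det^l.\<close>

lemma (in complex_algebra) proj_sym_power_equivariant:
  fixes \<rho> :: "complex^'g^'g \<Rightarrow> complex^'v^'v" and \<sigma> :: "complex^'g^'g \<Rightarrow> complex^'w^'w"
  assumes \<rho>: "rational_rep \<rho>" and \<sigma>: "rational_rep \<sigma>"
    and p: "equivariant_projection d \<rho> \<sigma> \<phi> p"
    and A: "A \<in> ring_GL R c" and v: "\<And>j. v j \<in> carrier R"
  shows "proj_over R c d p (sym_power R d (ring_mult_vec R (rep_over R c \<rho> A) v)) =
         ring_mult_vec R (rep_over R c \<sigma> A) (proj_over R c d p (sym_power R d v))"
proof
  fix r
  define D where "D = ring_det R c A"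
  have D: "D \<in> Units R" and closed: "A a b \<in> carrier R" for a b
    using A by (simp_all add: D_def ring_GL_def)
  have Dc: "D \<in> carrier R" and Di: "inv D \<in> carrier R"
    using D by (simp_all add: Units_closed)
  have cancel: "inv D [^] n \<otimes> D [^] n = \<one>" for n :: nat
    using D Dc Di by (simp add: nat_pow_distrib[symmetric] Units_l_inv)
  have eval: "poly_eval R c (\<lambda>(a, b). A a b) F \<in> carrier R" for F
    using closed by (intro poly_eval_closed) (simp split: prod.split)
  \<comment> \<open>The choice operator in \<open>rep_over\<close> returns some pair satisfying
    \<open>rational_coeffs\<close>; the rest of the argument works for any such pair.\<close>
  have rep: "\<exists>k P. rational_coeffs \<tau> k P \<and>
      rep_over R c \<tau> A = (\<lambda>i j. inv D [^] k \<otimes> poly_eval R c (\<lambda>(a, b). A a b) (P i j))"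
    if "rational_rep \<tau>" for \<tau> :: "complex^'g^'g \<Rightarrow> complex^'n^'n"
  proof -
    define kP where "kP = (SOME kP. rational_coeffs \<tau> (fst kP) (snd kP))"
    have "\<exists>kP. rational_coeffs \<tau> (fst kP) (snd kP)"
      using that by (auto simp: rational_rep_def)
    then have "rational_coeffs \<tau> (fst kP) (snd kP)"
      unfolding kP_def by (rule someI_ex)
    then show ?thesis
      by (intro exI[of _ "fst kP"] exI[of _ "snd kP"])
         (simp add: rep_over_def D_def kP_def[symmetric] case_prod_unfold)
  qed
  obtain k P where P: "rational_coeffs \<rho> k P" and rep_\<rho>:
    "rep_over R c \<rho> A = (\<lambda>i j. inv D [^] k \<otimes> poly_eval R c (\<lambda>(a, b). A a b) (P i j))"
    using rep[OF \<rho>] by blast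
  obtain l Q where Q: "rational_coeffs \<sigma> l Q" and rep_\<sigma>:
    "rep_over R c \<sigma> A = (\<lambda>i j. inv D [^] l \<otimes> poly_eval R c (\<lambda>(a, b). A a b) (Q i j))"
    using rep[OF \<sigma>] by blast
  define N where "N = proj_over R c d p (sym_power R d
    (ring_mult_vec R (\<lambda>i j. poly_eval R c (\<lambda>(a, b). A a b) (P i j)) v)) r"
  define M where "M = ring_mult_vec R (\<lambda>i j. poly_eval R c (\<lambda>(a, b). A a b) (Q i j))
    (proj_over R c d p (sym_power R d v)) r"
  have NM: "N \<in> carrier R" "M \<in> carrier R"
    unfolding N_def M_def
    by (intro proj_over_closed sym_power_closed mult_vec_closed eval v)+
  have "equivariance_lhs R c d p P l A v r = equivariance_rhs R c d p Q k A v r"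
    using equivariance_complex[OF p P Q] A v by (rule permanence_of_equivariance)
  then have eq: "D [^] l \<otimes> N = D [^] (k * d) \<otimes> M"
    by (simp add: equivariance_lhs_def equivariance_rhs_def D_def N_def M_def)
  have "proj_over R c d p (sym_power R d (ring_mult_vec R (rep_over R c \<rho> A) v)) r =
      inv D [^] (k * d) \<otimes> N"
  proof -
    have "ring_mult_vec R (rep_over R c \<rho> A) v = (\<lambda>i. inv D [^] k \<otimes>
        ring_mult_vec R (\<lambda>i j. poly_eval R c (\<lambda>(a, b). A a b) (P i j)) v i)"
      unfolding rep_\<rho> by (intro ext mult_vec_scale nat_pow_closed Di eval v)
    moreover have "sym_power R d (\<lambda>i. inv D [^] k \<otimes>
          ring_mult_vec R (\<lambda>i j. poly_eval R c (\<lambda>(a, b). A a b) (P i j)) v i) =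
        (\<lambda>m. (inv D [^] k) [^] d \<otimes>
          sym_power R d (ring_mult_vec R (\<lambda>i j. poly_eval R c (\<lambda>(a, b). A a b) (P i j)) v) m)"
      by (intro ext sym_power_scale nat_pow_closed Di mult_vec_closed eval v)
    ultimately show ?thesis
      unfolding N_def nat_pow_pow[OF Di, symmetric]
      by (simp only:) (intro proj_over_scale nat_pow_closed Di sym_power_closed mult_vec_closed eval v)
  qed
  \<comment> \<open>The factor 1 is inserted so that \<open>D [^] l \<otimes> N\<close>, the left
    side of \<open>eq\<close>, appears.\<close>
  also have "\<dots> = (inv D [^] l \<otimes> D [^] l) \<otimes> (inv D [^] (k * d) \<otimes> N)"
    using NM Di by (simp add: cancel)
  also have "\<dots> = inv D [^] l \<otimes> (inv D [^] (k * d) \<otimes> (D [^] l \<otimes> N))"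
    using NM Di Dc by (simp only: m_ac nat_pow_closed m_closed)
  also have "\<dots> = inv D [^] l \<otimes> ((inv D [^] (k * d) \<otimes> D [^] (k * d)) \<otimes> M)"
    unfolding eq using NM Di Dc by (simp only: m_assoc nat_pow_closed m_closed)
  also have "\<dots> = inv D [^] l \<otimes> M"
    using NM by (simp add: cancel)
  also have "\<dots> = ring_mult_vec R (rep_over R c \<sigma> A) (proj_over R c d p (sym_power R d v)) r"
    unfolding M_def rep_\<sigma>
    by (rule mult_vec_scale[symmetric])
       (intro nat_pow_closed Di eval proj_over_closed sym_power_closed v)+
  finally show "proj_over R c d p (sym_power R d (ring_mult_vec R (rep_over R c \<rho> A) v)) r =
      ring_mult_vec R (rep_over R c \<sigma> A) (proj_over R c d p (sym_power R d v)) r" .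
qed

lemma (in complex_algebra_hom) hom_proj_sym_power:
  assumes "\<And>i. v i \<in> carrier R"
  shows "h (proj_over R c d p (sym_power R d v) r) =
    proj_over S c' d p (sym_power S d (\<lambda>i. h (v i))) r"
  using assms by (simp add: hom_proj_over hom_sym_power R.sym_power_closed)

section \<open>Modular forms\<close>

lemma ringed_space_complex_algebra:
  assumes "ringed_space X" "openin (tops X) U"
  shows "complex_algebra (secs X U) (cst X U)"
  using assms
  by (auto simp: ringed_space_def complex_algebra_def complex_algebra_axioms_def complex_ring_eq)

lemma restriction_hom:
  assumes "ringed_space X" "openin (tops X) U" "openin (tops X) V" "U \<subseteq> V"
  shows "complex_algebra_hom (secs X V) (cst X V) (secs X U) (cst X U) (res X V U)"
  using assms ringed_space_complex_algebra[OF assms(1)]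
  by (auto simp: ringed_space_def complex_algebra_hom_def complex_algebra_hom_axioms_def)

lemma openin_preim:
  assumes "morphism X Y m" "openin (tops Y) V"
  shows "openin (tops X) (preim X (fst m) V)"
  using assms by (auto simp: morphism_def preim_def continuous_map_def)

lemma comorphism_hom:
  assumes "ringed_space X" "ringed_space Y" "morphism X Y m" "openin (tops Y) V"
  shows "complex_algebra_hom (secs Y V) (cst Y V)
    (secs X (preim X (fst m) V)) (cst X (preim X (fst m) V)) (snd m V)"
  using assms ringed_space_complex_algebra[OF assms(1) openin_preim[OF assms(3,4)]]
    ringed_space_complex_algebra[OF assms(2,4)]
  by (auto simp: morphism_def complex_algebra_hom_def complex_algebra_hom_axioms_def)

lemma overlap_schur_bundle: "overlap X (schur_bundle X E \<tau>) = overlap X E"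
  by (intro ext) (simp add: overlap_def schur_bundle_def)

text \<open>One argument covers the transition functions on a single space (identity arrows) and
  descent data or factors of automorphy (other arrows), since pullback followed by restriction is
  again a homomorphism of complex algebras.\<close>

lemma apply_concomitant_modular_form:
  assumes X: "analytic_stack X" and E: "vector_bundle X E"
    and \<rho>: "rational_rep \<rho>" and \<sigma>: "rational_rep \<sigma>" and f: "modular_form X E \<rho> f"
    and p: "equivariant_projection d \<rho> \<sigma> \<phi> p"
  shows "modular_form X E \<sigma> (apply_concomitant X E d p f)"
proof -
  have ringed: "ringed_space (spc X x)" if "x \<in> objs X" for x
    using X that by (auto simp: analytic_stack_def complex_space_def)
  have arrow: "src X a \<in> objs X" "tgt X a \<in> objs X"
      "morphism (spc X (src X a)) (spc X (tgt X a)) (mor X a)" if "a \<in> arrs X" for a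
    using X that by (auto simp: analytic_stack_def)
  have nbh: "openin (tops (spc X x)) (nbh E x i)" if "x \<in> objs X" "i \<in> idx E x" for x i
    using E that by (auto simp: vector_bundle_def)
  have GL: "trans E a i k \<in> ring_GL (secs (spc X (src X a)) (overlap X E a i k))
      (cst (spc X (src X a)) (overlap X E a i k))"
    if "a \<in> arrs X" "i \<in> idx E (src X a)" "k \<in> idx E (tgt X a)" for a i k
    using E that by (auto simp: vector_bundle_def)
  have f_closed: "f x i r \<in> carrier (secs (spc X x) (nbh E x i))"
    if "x \<in> objs X" "i \<in> idx E x" for x i r
    using f that by (auto simp: modular_form_def bundle_section_def schur_bundle_def)
  have f_trans: "(\<lambda>r. res S (nbh E (src X a) i) T (f (src X a) i r)) =
      ring_mult_vec (secs S T) (rep_over (secs S T) (cst S T) \<rho> (trans E a i k))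
        (\<lambda>r. res S (preim S (base_map X a) (nbh E (tgt X a) k)) T
          (pullback X a (nbh E (tgt X a) k) (f (tgt X a) k r)))"
    if "a \<in> arrs X" "i \<in> idx E (src X a)" "k \<in> idx E (tgt X a)"
      "S = spc X (src X a)" "T = overlap X E a i k" for a i k S T
    using f that
    by (simp add: modular_form_def bundle_section_def overlap_schur_bundle Let_def)
       (simp add: schur_bundle_def)
  show ?thesis
    unfolding modular_form_def bundle_section_def
  proof (intro conjI ballI allI)
    fix x i r
    assume "x \<in> objs X" "i \<in> idx (schur_bundle X E \<sigma>) x"
    then have x: "x \<in> objs X" "i \<in> idx E x" by (simp_all add: schur_bundle_def)
    interpret complex_algebra "secs (spc X x) (nbh E x i)" "cst (spc X x) (nbh E x i)"
      by (intro ringed_space_complex_algebra ringed nbh x)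
    show "apply_concomitant X E d p f x i r
        \<in> carrier (secs (spc X x) (nbh (schur_bundle X E \<sigma>) x i))"
      using x by (simp add: apply_concomitant_def Let_def schur_bundle_def
          proj_over_closed sym_power_closed f_closed)
  next
    fix a i k
    assume "a \<in> arrs X" "i \<in> idx (schur_bundle X E \<sigma>) (src X a)"
      "k \<in> idx (schur_bundle X E \<sigma>) (tgt X a)"
    then have a: "a \<in> arrs X" "i \<in> idx E (src X a)" "k \<in> idx E (tgt X a)"
      by (simp_all add: schur_bundle_def)
    define S where "S = spc X (src X a)"
    define Y where "Y = spc X (tgt X a)"
    define T where "T = overlap X E a i k"
    define U where "U = nbh E (src X a) i"
    define V where "V = nbh E (tgt X a) k"
    define V' where "V' = preim S (base_map X a) V"
    have S: "ringed_space S" and Y: "ringed_space Y" and m: "morphism S Y (mor X a)"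
      using arrow[OF a(1)] ringed by (simp_all add: S_def Y_def)
    have U: "openin (tops S) U" and V: "openin (tops Y) V"
      using nbh arrow[OF a(1)] a by (simp_all add: S_def Y_def U_def V_def)
    have V': "openin (tops S) V'"
      unfolding V'_def by (rule openin_preim[OF m V])
    have T_eq: "T = U \<inter> V'"
      by (simp add: T_def overlap_def U_def V'_def V_def S_def)
    have T: "openin (tops S) T"
      unfolding T_eq using U V' by (rule openin_Int)
    interpret U: complex_algebra_hom "secs S U" "cst S U" "secs S T" "cst S T" "res S U T"
      using S T U by (rule restriction_hom) (simp add: T_eq)
    interpret V': complex_algebra_hom "secs S V'" "cst S V'" "secs S T" "cst S T" "res S V' T"
      using S T V' by (rule restriction_hom) (simp add: T_eq)
    interpret V: complex_algebra_hom "secs Y V" "cst Y V" "secs S V'" "cst S V'" "pullback X a V"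
      unfolding V'_def using S Y m V by (rule comorphism_hom)
    have fU: "f (src X a) i r \<in> carrier (secs S U)" for r
      using f_closed arrow[OF a(1)] a by (simp add: S_def U_def)
    have fV: "f (tgt X a) k r \<in> carrier (secs Y V)" for r
      using f_closed arrow[OF a(1)] a by (simp add: Y_def V_def)
    \<comment> \<open>The component of f at the target, pulled back along the arrow and restricted
      to the overlap: the vector on which the transition matrix acts.\<close>
    define u where "u = (\<lambda>r. res S V' T (pullback X a V (f (tgt X a) k r)))"
    have u: "u r \<in> carrier (secs S T)" for r
      unfolding u_def by (intro V'.hom_closed V.hom_closed fV)
    have f_glue: "(\<lambda>r. res S U T (f (src X a) i r)) =
        ring_mult_vec (secs S T) (rep_over (secs S T) (cst S T) \<rho> (trans E a i k)) u"
      using f_trans[OF a S_def T_def] by (simp add: U_def V_def V'_def u_def)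
    have g: "trans E a i k \<in> ring_GL (secs S T) (cst S T)"
      using GL[OF a] by (simp add: S_def T_def)
    have "(\<lambda>r. res S U T (apply_concomitant X E d p f (src X a) i r)) =
        proj_over (secs S T) (cst S T) d p
          (sym_power (secs S T) d (\<lambda>r. res S U T (f (src X a) i r)))"
      using U.hom_proj_sym_power[of "f (src X a) i" d p, OF fU]
      by (simp add: apply_concomitant_def Let_def S_def U_def fun_eq_iff)
    also have "\<dots> = ring_mult_vec (secs S T) (rep_over (secs S T) (cst S T) \<sigma> (trans E a i k))
        (proj_over (secs S T) (cst S T) d p (sym_power (secs S T) d u))"
      unfolding f_glue by (rule U.S.proj_sym_power_equivariant[OF \<rho> \<sigma> p g u])
    \<comment> \<open>Naturality is used twice, for the comorphism from V to its preimage V' and for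
      the restriction from V' to T.\<close>
    also have "proj_over (secs S T) (cst S T) d p (sym_power (secs S T) d u) =
        (\<lambda>r. res S V' T (pullback X a V (apply_concomitant X E d p f (tgt X a) k r)))"
      using V.hom_proj_sym_power[of "f (tgt X a) k" d p, OF fV]
        V'.hom_proj_sym_power[of "\<lambda>r. pullback X a V (f (tgt X a) k r)" d p, OF V.hom_closed[OF fV]]
      by (simp add: apply_concomitant_def Let_def Y_def[symmetric] V_def[symmetric] u_def
          fun_eq_iff)
    finally show "let S = spc X (src X a); T = overlap X (schur_bundle X E \<sigma>) a i k in
        (\<lambda>r. res S (nbh (schur_bundle X E \<sigma>) (src X a) i) T
          (apply_concomitant X E d p f (src X a) i r)) =
        ring_mult_vec (secs S T) (trans (schur_bundle X E \<sigma>) a i k)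
          (\<lambda>r. res S (preim S (base_map X a) (nbh (schur_bundle X E \<sigma>) (tgt X a) k)) T
            (pullback X a (nbh (schur_bundle X E \<sigma>) (tgt X a) k)
              (apply_concomitant X E d p f (tgt X a) k r)))"
      by (simp add: Let_def overlap_schur_bundle)
         (simp add: schur_bundle_def S_def T_def U_def V_def V'_def)
  qed
qed

theorem mainTheorem2:
  fixes X :: "('o, 'a, 'x, 'r) diagram"
    and E :: "('o, 'a, 'i, 'x, 'g::{finite, linorder}, 'r) cocycle"
    and V :: "complex^'g::_^'g::_ \<Rightarrow> complex^'v^'v"
    and W :: "complex^'g::_^'g::_ \<Rightarrow> complex^'w^'w"
    and \<rho> \<sigma> :: "'g \<Rightarrow> int"
    and f :: "'o \<Rightarrow> 'i \<Rightarrow> 'v \<Rightarrow> 'r"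
    and d :: nat
    and \<phi> :: "complex^'w \<Rightarrow> ('v \<Rightarrow>\<^sub>0 nat) \<Rightarrow>\<^sub>0 complex"
    and p :: "(('v \<Rightarrow>\<^sub>0 nat) \<Rightarrow>\<^sub>0 complex) \<Rightarrow> complex^'w"
  assumes "analytic_stack X"
    and "vector_bundle X E"
    and "irreducible_rep V" and "has_highest_weight V \<rho>"
    and "irreducible_rep W" and "has_highest_weight W \<sigma>"
    and "modular_form X E V f"
    and "concomitant d V W \<phi>"
    and "equivariant_projection d V W \<phi> p"
  shows "modular_form X E W (apply_concomitant X E d p f)"
  using assms apply_concomitant_modular_form
  by (auto simp: irreducible_rep_def)

end
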